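(* Let $E_{2,0}=\sum_{k\ge1}c_k[p]\frac{\partial}{\partial\pi_k}$ and $F_{2,-1}=-\sum_{k\ge1}\pi_k\,\widetilde c_k[\partial/\partial p]$, let $H_{2,-1}$ be the operator on $\mathcal R$ determined by $[E_{2,0},F_{2,-1}]_+=1-(t/q)^{1/2}u\,H_{2,-1}$, and define $$\mathcal D_2:=\frac{1}{1-t}\left((t/q)^{1/2}u\,H_{2,-1}-1\right)=\mathcal D_2^B+\mathcal D_2^F,$$ where $\mathcal D_2^B$ is the bosonic part (involving only $p_k,\partial/\partial p_k$) and $\mathcal D_2^F$ is the fermionic part (the normal ordered terms involving $\pi_k,\partial/\partial\pi_k$). Then: (i) $\mathcal D_2^B$ agrees with the $(q,t)$-inverted Ruijsenaars-Macdonald Hamiltonian: for every $N\ge1$ and every $f\in K[p_1,p_2,\dots]$, after the substitution $p_k\mapsto\sum_{i=1}^Nx_i^k$ one has $$\mathcal D_2^Bf=\left(t^{N-1}\sum_{i=1}^N\prod_{j\ne i}\frac{t^{-1}x_i-x_j}{x_i-x_j}\,\tau_i^{-1}-\frac{1-t^N}{1-t}\right)f ,$$ where $\tau_i^{-1}$ is the shift $x_i\mapsto q^{-1}x_i$. (ii) $\mathcal D_2^F$ is bilinear in the fermions: $$\mathcal D_2^F=\frac{1}{1-t}\sum_{k=1}^\infty\sum_{\ell=1}^\infty\widetilde C_{k,\ell}[p,\partial/\partial p]\;\pi_k\frac{\partial}{\partial\pi_\ell},$$ where $$\widetilde C_{k,\ell}[p,\partial/\partial p]=(1-t)(q^{-1}-1)\sum_{n=\ell-k}^{\ell-1}[[\ell-n]]_{(q^{-1},t)}\;c_n[p]\;\widetilde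 c_{k-\ell+n}[\partial/\partial p].$$
   Context: Let $q,t,u$ be indeterminates, $K=\mathbb Q(q^{1/2},t^{1/2},u)$, and $\mathcal R=K[p_1,p_2,\dots]\otimes\Lambda_K(\pi_1,\pi_2,\dots)$ (polynomial ring tensor exterior algebra). $p_k$ and $\pi_k$ act by multiplication; $\partial/\partial p_k$ is the usual derivative and $\partial/\partial\pi_k$ the left (odd) derivative, so $\{\partial/\partial\pi_k,\pi_l\}=\delta_{kl}$. $[A,B]_+=AB+BA$. Infinite sums of operators are finite on each element of $\mathcal R$. Normal ordered means all $\pi$'s are to the left of all $\partial/\partial\pi$'s. Define $c_k[p]$ and $\widetilde c_k[\partial/\partial p]$ by $$\sum_{k\ge0}c_k[p]z^k=\exp\Big(\sum_{r\ge1}\tfrac{1-t^r}{r}p_rz^r\Big),\qquad \sum_{k\ge0}\widetilde c_k[\partial/\partial p]z^{-k}=\exp\Big(\sum_{n\ge1}(q^{-n}-1)\tfrac{\partial}{\partial p_n}z^{-n}\Big),$$ with $c_n=\widetilde c_n=0$ for $n<0$. Notation: $[[n]]_{(t_1,t_2)}=\frac{t_1^n-t_2^n}{t_1-t_2}$. *)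

theory Defs
  imports
    "HOL-Computational_Algebra.Computational_Algebra"
    "HOL-Library.Poly_Mapping"
    "HOL-Library.FSet"
begin

section \<open>The coefficient field and the polynomial ring\<close>

text \<open>The field of rational functions over the rationals in three indeterminates, built as an
  iterated field of fractions. The indeterminates are, from the innermost to the outermost layer,
  the square root of \<open>q\<close>, the square root of \<open>t\<close>, and \<open>u\<close>.\<close>

type_synonym coeff_field = "rat poly fract poly fract poly fract"

definition qh :: coeff_field where
  "qh = Fract [: Fract [: Fract [:0, 1:] 1 :] 1 :] 1"

definition th :: coeff_field where
  "th = Fract [: Fract [:0, 1:] 1 :] 1"

definition uu :: coeff_field where
  "uu = Fract [:0, 1:] 1"

definition qq :: coeff_field where "qq = qh\<^sup>2"

definition tt :: coeff_field where "tt = th\<^sup>2"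

text \<open>Polynomials in countably many variables. Indices are shifted: the variable with one-based
  index \<open>k\<close> (written \<open>p_k\<close> or \<open>x_k\<close> in mathematics) occupies slot \<open>k - 1\<close>, so that no spurious
  variable with index 0 exists. The operators below are only ever used with \<open>k \<ge> 1\<close>.\<close>

type_synonym kpoly = "(nat \<Rightarrow>\<^sub>0 nat) \<Rightarrow>\<^sub>0 coeff_field"

definition scal :: "coeff_field \<Rightarrow> kpoly" where
  "scal a = Poly_Mapping.single 0 a"

definition var :: "nat \<Rightarrow> kpoly" where
  "var k = Poly_Mapping.single (Poly_Mapping.single (k - 1) 1) 1"

definition poly_subst :: "(nat \<Rightarrow> kpoly) \<Rightarrow> kpoly \<Rightarrow> kpoly" where
  "poly_subst \<phi> f = (\<Sum>\<alpha>\<in>Poly_Mapping.keys f. scal (Poly_Mapping.lookup f \<alpha>) *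
      (\<Prod>i\<in>Poly_Mapping.keys \<alpha>. \<phi> (Suc i) ^ Poly_Mapping.lookup \<alpha> i))"

definition dp :: "nat \<Rightarrow> kpoly \<Rightarrow> kpoly" where
  "dp k f = (\<Sum>\<alpha>\<in>Poly_Mapping.keys f.
      Poly_Mapping.single (\<alpha> - Poly_Mapping.single (k - 1) 1)
        (of_nat (Poly_Mapping.lookup \<alpha> (k - 1)) * Poly_Mapping.lookup f \<alpha>))"

text \<open>The monomial \<open>\<alpha>\<close> evaluated at the commuting operators \<open>\<partial>/\<partial>p_1, \<partial>/\<partial>p_2, \<dots>\<close>, and the resulting
  evaluation of a polynomial \<open>P\<close>, i.e. \<open>P[\<partial>/\<partial>p]\<close>.\<close>

definition dp_monom :: "(nat \<Rightarrow>\<^sub>0 nat) \<Rightarrow> kpoly \<Rightarrow> kpoly" where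
  "dp_monom \<alpha> = fold (\<lambda>i. dp (Suc i) ^^ Poly_Mapping.lookup \<alpha> i)
      (sorted_list_of_set (Poly_Mapping.keys \<alpha>))"

definition at_dp :: "kpoly \<Rightarrow> kpoly \<Rightarrow> kpoly" where
  "at_dp P f = (\<Sum>\<alpha>\<in>Poly_Mapping.keys P. scal (Poly_Mapping.lookup P \<alpha>) * dp_monom \<alpha> f)"


section \<open>The polynomial ring tensor exterior algebra\<close>

text \<open>An element is a finitely supported family of polynomials: the entry at the finite set with
  slots \<open>i_1 < \<dots> < i_r\<close> is the coefficient of \<open>\<pi>_{i_1+1} \<dots> \<pi>_{i_r+1}\<close> (increasing order).\<close>

type_synonym superpoly = "nat fset \<Rightarrow>\<^sub>0 kpoly"

definition from_poly :: "kpoly \<Rightarrow> superpoly" where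
  "from_poly f = Poly_Mapping.single {||} f"

text \<open>For an additive operator \<open>L\<close> on polynomials this is \<open>L \<otimes> id\<close>; no sign arises because
  polynomials are even.\<close>

definition lift_op :: "(kpoly \<Rightarrow> kpoly) \<Rightarrow> superpoly \<Rightarrow> superpoly" where
  "lift_op L = Poly_Mapping.map L"

definition smult_R :: "coeff_field \<Rightarrow> superpoly \<Rightarrow> superpoly" where
  "smult_R a = lift_op (\<lambda>f. scal a * f)"

text \<open>The sign from moving \<open>\<pi>_k\<close> to its place in an increasing exterior monomial.\<close>

definition ext_sign :: "nat \<Rightarrow> nat fset \<Rightarrow> kpoly" where
  "ext_sign k I = (- 1) ^ card {i. i |\<in>| I \<and> i < k - 1}"

definition pi_op :: "nat \<Rightarrow> superpoly \<Rightarrow> superpoly" where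
  "pi_op k x = (\<Sum>I\<in>Poly_Mapping.keys x. if k - 1 |\<in>| I then 0 else
      Poly_Mapping.single (finsert (k - 1) I) (ext_sign k I * Poly_Mapping.lookup x I))"

definition dpi_op :: "nat \<Rightarrow> superpoly \<Rightarrow> superpoly" where
  "dpi_op k x = (\<Sum>I\<in>Poly_Mapping.keys x. if k - 1 |\<in>| I then
      Poly_Mapping.single (I |-| {|k - 1|}) (ext_sign k I * Poly_Mapping.lookup x I) else 0)"


section \<open>Operators\<close>

text \<open>Infinite sums of operators, meaningful when they are finite on each element.\<close>

definition op_sum :: "'i set \<Rightarrow> ('i \<Rightarrow> 'a \<Rightarrow> 'b::comm_monoid_add) \<Rightarrow> 'a \<Rightarrow> 'b" where
  "op_sum S A x = (\<Sum>k\<in>{k\<in>S. A k x \<noteq> 0}. A k x)"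

definition locally_finite :: "'i set \<Rightarrow> ('i \<Rightarrow> 'a \<Rightarrow> 'b::zero) \<Rightarrow> bool" where
  "locally_finite S A \<longleftrightarrow> (\<forall>x. finite {k\<in>S. A k x \<noteq> 0})"

definition anticommutator ::
    "('a \<Rightarrow> 'a) \<Rightarrow> ('a \<Rightarrow> 'a) \<Rightarrow> 'a \<Rightarrow> 'a::plus" where
  "anticommutator A B x = A (B x) + B (A x)"

text \<open>Operators on polynomials expressible through \<open>p_k\<close> and \<open>\<partial>/\<partial>p_k\<close> only. The sum is automatically
  finite on each polynomial, as shown by \<open>locally_finite_diff_op\<close> below.\<close>

definition boson_op :: "(kpoly \<Rightarrow> kpoly) \<Rightarrow> bool" where
  "boson_op L \<longleftrightarrow> (\<exists>a :: (nat \<Rightarrow>\<^sub>0 nat) \<Rightarrow> kpoly. L = op_sum UNIV (\<lambda>\<alpha> f. a \<alpha> * dp_monom \<alpha> f))"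

definition pi_monom :: "nat fset \<Rightarrow> superpoly \<Rightarrow> superpoly" where
  "pi_monom I = foldr (\<lambda>i. pi_op (Suc i)) (sorted_list_of_fset I)"

definition dpi_monom :: "nat fset \<Rightarrow> superpoly \<Rightarrow> superpoly" where
  "dpi_monom J = foldr (\<lambda>i. dpi_op (Suc i)) (sorted_list_of_fset J)"

text \<open>Sums of normal ordered terms, each containing at least one \<open>\<pi>\<close> or \<open>\<partial>/\<partial>\<pi>\<close>.\<close>

definition fermion_op :: "(superpoly \<Rightarrow> superpoly) \<Rightarrow> bool" where
  "fermion_op T \<longleftrightarrow> (\<exists>B :: nat fset \<times> nat fset \<Rightarrow> kpoly \<Rightarrow> kpoly.
     let A = (\<lambda>(I, J) x. lift_op (B (I, J)) (pi_monom I (dpi_monom J x)));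
         S = UNIV - {({||}, {||})}
     in (\<forall>IJ\<in>S. boson_op (B IJ)) \<and> locally_finite S A \<and> T = op_sum S A)"

text \<open>The bosonic part is recorded as an operator on polynomials.\<close>

definition boson_fermion_parts ::
    "(superpoly \<Rightarrow> superpoly) \<Rightarrow> (kpoly \<Rightarrow> kpoly) \<Rightarrow> (superpoly \<Rightarrow> superpoly) \<Rightarrow> bool" where
  "boson_fermion_parts T TB TF \<longleftrightarrow>
     boson_op TB \<and> fermion_op TF \<and> T = (\<lambda>x. lift_op TB x + TF x)"


section \<open>The operators of the proposition\<close>

definition exp_series :: "kpoly fps" where
  "exp_series = Abs_fps (\<lambda>m. scal (1 / fact m))"

definition c_series :: "kpoly fps" where
  "c_series = exp_series oo
     Abs_fps (\<lambda>r. if r = 0 then 0 else scal ((1 - tt ^ r) / of_nat r) * var r)"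

definition cc :: "int \<Rightarrow> kpoly" where
  "cc n = (if n < 0 then 0 else fps_nth c_series (nat n))"

text \<open>The series variable stands for \<open>z^{-1}\<close>, and \<open>var n\<close> for \<open>\<partial>/\<partial>p_n\<close>.\<close>

definition ct_series :: "kpoly fps" where
  "ct_series = exp_series oo
     Abs_fps (\<lambda>n. if n = 0 then 0 else scal (inverse qq ^ n - 1) * var n)"

definition ct_op :: "int \<Rightarrow> kpoly \<Rightarrow> kpoly" where
  "ct_op n = (if n < 0 then (\<lambda>f. 0) else at_dp (fps_nth ct_series (nat n)))"

definition E20 :: "superpoly \<Rightarrow> superpoly" where
  "E20 = op_sum {1..} (\<lambda>k x. lift_op (\<lambda>f. cc (int k) * f) (dpi_op k x))"

definition F2m1 :: "superpoly \<Rightarrow> superpoly" where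
  "F2m1 x = - op_sum {1..} (\<lambda>k x. pi_op k (lift_op (ct_op (int k)) x)) x"

definition D2 :: "(superpoly \<Rightarrow> superpoly) \<Rightarrow> superpoly \<Rightarrow> superpoly" where
  "D2 H x = smult_R (1 / (1 - tt)) (smult_R (th / qh * uu) (H x) - x)"

definition qnum :: "int \<Rightarrow> coeff_field \<Rightarrow> coeff_field \<Rightarrow> coeff_field" where
  "qnum n t1 t2 = (t1 powi n - t2 powi n) / (t1 - t2)"

definition Ctilde :: "nat \<Rightarrow> nat \<Rightarrow> kpoly \<Rightarrow> kpoly" where
  "Ctilde k l f = scal ((1 - tt) * (inverse qq - 1)) *
     (\<Sum>n = int l - int k..int l - 1.
        scal (qnum (int l - n) (inverse qq) tt) * (cc n * ct_op (int k - int l + n) f))"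


section \<open>The inverted Ruijsenaars-Macdonald Hamiltonian in finitely many variables\<close>

text \<open>Here \<open>var i\<close> plays the role of \<open>x_i\<close>.\<close>

definition power_sum_subst :: "nat \<Rightarrow> kpoly \<Rightarrow> kpoly" where
  "power_sum_subst N = poly_subst (\<lambda>k. \<Sum>i = 1..N. var i ^ k)"

definition shift_inv :: "nat \<Rightarrow> kpoly \<Rightarrow> kpoly" where
  "shift_inv i = poly_subst (\<lambda>j. if j = i then scal (inverse qq) * var j else var j)"

definition to_frac :: "kpoly \<Rightarrow> kpoly fract" where
  "to_frac g = Fract g 1"

definition RM_inverted :: "nat \<Rightarrow> kpoly \<Rightarrow> kpoly fract" where
  "RM_inverted N g =
     to_frac (scal (tt ^ (N - 1))) *
       (\<Sum>i = 1..N.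
          (\<Prod>j \<in> {1..N} - {i}. (to_frac (scal (inverse tt) * var i) - to_frac (var j)) /
                                   (to_frac (var i) - to_frac (var j)))
          * to_frac (shift_inv i g))
     - to_frac (scal ((1 - tt ^ N) / (1 - tt))) * to_frac g"


section \<open>The fermion algebra, and finiteness of the infinite sums\<close>

declare One_nat_def [simp del]

lemma lookup_pi_op:
  "Poly_Mapping.lookup (pi_op k x) J =
    (if k - 1 |\<in>| J then ext_sign k J * Poly_Mapping.lookup x (J |-| {|k - 1|}) else 0)"
proof -
  have sgn: "ext_sign k (J |-| {|k - 1|}) = ext_sign k J" for J
    unfolding ext_sign_def by (rule arg_cong[where f="\<lambda>s. (-1) ^ card s"]) auto
  have "Poly_Mapping.lookup (pi_op k x) J =
     (\<Sum>I\<in>Poly_Mapping.keys x. if k - 1 |\<in>| J \<and> I = J |-| {|k - 1|}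
        then ext_sign k I * Poly_Mapping.lookup x I else 0)"
    unfolding pi_op_def lookup_sum by (rule sum.cong) (auto simp: lookup_single when_def)
  also have "\<dots> = (if k - 1 |\<in>| J then ext_sign k J * Poly_Mapping.lookup x (J |-| {|k - 1|}) else 0)"
    by (auto simp: sum.delta' sgn in_keys_iff)
  finally show ?thesis .
qed

lemma lookup_dpi_op:
  "Poly_Mapping.lookup (dpi_op k x) J =
    (if k - 1 |\<in>| J then 0 else ext_sign k J * Poly_Mapping.lookup x (finsert (k - 1) J))"
proof -
  have sgn: "ext_sign k (finsert (k - 1) J) = ext_sign k J" for J
    unfolding ext_sign_def by (rule arg_cong[where f="\<lambda>s. (-1) ^ card s"]) auto
  have "Poly_Mapping.lookup (dpi_op k x) J =
     (\<Sum>I\<in>Poly_Mapping.keys x. if k - 1 |\<notin>| J \<and> I = finsert (k - 1) J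
        then ext_sign k I * Poly_Mapping.lookup x I else 0)"
    unfolding dpi_op_def lookup_sum by (rule sum.cong) (auto simp: lookup_single when_def)
  also have "\<dots> = (if k - 1 |\<in>| J then 0 else ext_sign k J * Poly_Mapping.lookup x (finsert (k - 1) J))"
    by (auto simp: sum.delta' sgn in_keys_iff)
  finally show ?thesis .
qed

lemma ext_sign_square: "ext_sign k J * (ext_sign k J * f) = f"
  by (simp add: ext_sign_def flip: mult.assoc power_mult_distrib)

lemma ext_sign_finsert:
  assumes "k \<ge> 1" "l \<ge> 1" "l - 1 |\<notin>| J"
  shows "ext_sign k (finsert (l - 1) J) = (if l < k then - ext_sign k J else ext_sign k J)"
proof (cases "l < k")
  case True
  then have "{i. i |\<in>| finsert (l - 1) J \<and> i < k - 1} = insert (l - 1) {i. i |\<in>| J \<and> i < k - 1}"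
    using assms by auto
  moreover have "finite {i. i |\<in>| J \<and> i < k - 1}" by simp
  ultimately show ?thesis using True assms by (simp add: ext_sign_def)
next
  case False
  then have "{i. i |\<in>| finsert (l - 1) J \<and> i < k - 1} = {i. i |\<in>| J \<and> i < k - 1}"
    using assms by auto
  then show ?thesis using False by (simp add: ext_sign_def)
qed

lemma ext_sign_fminus:
  assumes "k \<ge> 1" "l \<ge> 1" "l - 1 |\<in>| J"
  shows "ext_sign k (J |-| {|l - 1|}) = (if l < k then - ext_sign k J else ext_sign k J)"
  using ext_sign_finsert[OF assms(1,2), of "J |-| {|l - 1|}"] assms(3)
  by (auto simp: finsert_absorb split: if_splits)

lemma anticommutator_dpi_pi:
  assumes "k \<ge> 1" "l \<ge> 1"
  shows "anticommutator (dpi_op k) (pi_op l) x = (if k = l then x else 0)"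
proof (rule poly_mapping_eqI)
  fix J
  have *: "k - 1 = l - 1 \<longleftrightarrow> k = l" using assms by auto
  have fs: "finsert (k - 1) J |-| {|l - 1|} = finsert (k - 1) (J |-| {|l - 1|})" if "k \<noteq> l"
    using that * by auto
  show "Poly_Mapping.lookup (anticommutator (dpi_op k) (pi_op l) x) J
      = Poly_Mapping.lookup (if k = l then x else 0) J"
  proof (cases "k = l")
    case True
    then show ?thesis using assms
      by (auto simp: anticommutator_def lookup_add lookup_pi_op lookup_dpi_op ext_sign_fminus
          ext_sign_finsert ext_sign_square finsert_absorb)
  next
    case False
    then show ?thesis using assms *
      by (auto simp: anticommutator_def lookup_add lookup_pi_op lookup_dpi_op ext_sign_fminus
          ext_sign_finsert fs algebra_simps)
  qed
qed

lemma anticommutator_pi_pi: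
  assumes "k \<ge> 1" "l \<ge> 1"
  shows "anticommutator (pi_op k) (pi_op l) x = 0"
proof (rule poly_mapping_eqI)
  fix J
  have *: "k - 1 = l - 1 \<longleftrightarrow> k = l" using assms by auto
  have fs: "J |-| {|k - 1|} |-| {|l - 1|} = J |-| {|l - 1|} |-| {|k - 1|}" by auto
  show "Poly_Mapping.lookup (anticommutator (pi_op k) (pi_op l) x) J = Poly_Mapping.lookup 0 J"
    using assms * by (auto simp: anticommutator_def lookup_add lookup_pi_op ext_sign_fminus fs algebra_simps)
qed

lemma dpi_op_from_poly: "dpi_op k (from_poly f) = 0"
  by (rule poly_mapping_eqI) (auto simp: lookup_dpi_op from_poly_def lookup_single when_def)

text \<open>The grading in which \<open>p_k\<close> has weight \<open>k\<close>.\<close>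

definition weight :: "(nat \<Rightarrow>\<^sub>0 nat) \<Rightarrow> nat" where
  "weight \<alpha> = (\<Sum>i\<in>Poly_Mapping.keys \<alpha>. Suc i * Poly_Mapping.lookup \<alpha> i)"

lemma weight_add: "weight (\<alpha> + \<beta>) = weight \<alpha> + weight \<beta>"
  unfolding weight_def by (rule setsum_keys_plus_distrib) (auto simp: algebra_simps)

lemma weight_0 [simp]: "weight 0 = 0"
  by (simp add: weight_def)

lemma weight_single [simp]: "weight (Poly_Mapping.single i n) = Suc i * n"
  by (cases "n = 0") (auto simp: weight_def)

lemma weight_dp:
  assumes "\<gamma> \<in> Poly_Mapping.keys (dp (Suc i) f)"
  shows "\<exists>\<beta>\<in>Poly_Mapping.keys f. weight \<gamma> + Suc i = weight \<beta>"
proof -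
  let ?e = "Poly_Mapping.single i 1 :: nat \<Rightarrow>\<^sub>0 nat"
  have "Poly_Mapping.lookup (dp (Suc i) f) \<gamma> \<noteq> 0" using assms by (simp add: in_keys_iff)
  then obtain \<beta> where b: "\<beta> \<in> Poly_Mapping.keys f" "\<gamma> = \<beta> - ?e" "Poly_Mapping.lookup \<beta> i \<noteq> 0"
    unfolding dp_def lookup_sum
    by (elim sum.not_neutral_contains_not_neutral)
       (fastforce simp: lookup_single when_def split: if_splits)
  have "\<beta> = \<gamma> + ?e"
    using b(2,3) by (intro poly_mapping_eqI) (auto simp: lookup_add lookup_minus lookup_single when_def)
  then have "weight \<gamma> + Suc i = weight \<beta>" by (simp add: weight_add One_nat_def)
  then show ?thesis using b(1) by blast
qed

lemma weight_dp_pow: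
  assumes "\<gamma> \<in> Poly_Mapping.keys ((dp (Suc i) ^^ m) f)"
  shows "\<exists>\<beta>\<in>Poly_Mapping.keys f. weight \<gamma> + Suc i * m = weight \<beta>"
  using assms
proof (induction m arbitrary: \<gamma>)
  case (Suc m)
  then obtain \<delta> where "\<delta> \<in> Poly_Mapping.keys ((dp (Suc i) ^^ m) f)" "weight \<gamma> + Suc i = weight \<delta>"
    using weight_dp by fastforce
  moreover from this(1) obtain \<beta> where "\<beta> \<in> Poly_Mapping.keys f" "weight \<delta> + Suc i * m = weight \<beta>"
    using Suc.IH by blast
  ultimately have "weight \<gamma> + Suc i * Suc m = weight \<beta>" by (simp add: algebra_simps)
  then show ?case using \<open>\<beta> \<in> _\<close> by blast
qed auto

lemma weight_dp_fold:
  assumes "\<gamma> \<in> Poly_Mapping.keys (fold (\<lambda>i. dp (Suc i) ^^ a i) is f)"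
  shows "\<exists>\<beta>\<in>Poly_Mapping.keys f. weight \<gamma> + (\<Sum>i\<leftarrow>is. Suc i * a i) = weight \<beta>"
  using assms
proof (induction "is" arbitrary: f)
  case (Cons i "is")
  then obtain \<delta> where "\<delta> \<in> Poly_Mapping.keys ((dp (Suc i) ^^ a i) f)"
    "weight \<gamma> + (\<Sum>i\<leftarrow>is. Suc i * a i) = weight \<delta>"
    by fastforce
  moreover from weight_dp_pow[OF this(1)] obtain \<beta>
    where "\<beta> \<in> Poly_Mapping.keys f" "weight \<delta> + Suc i * a i = weight \<beta>" by blast
  ultimately have "weight \<gamma> + (\<Sum>i\<leftarrow>i # is. Suc i * a i) = weight \<beta>" by (simp add: algebra_simps)
  then show ?case using \<open>\<beta> \<in> _\<close> by blast
qed auto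

lemma weight_dp_monom:
  assumes "\<gamma> \<in> Poly_Mapping.keys (dp_monom \<alpha> f)"
  shows "\<exists>\<beta>\<in>Poly_Mapping.keys f. weight \<gamma> + weight \<alpha> = weight \<beta>"
proof -
  have "weight \<alpha> = (\<Sum>i\<leftarrow>sorted_list_of_set (Poly_Mapping.keys \<alpha>). Suc i * Poly_Mapping.lookup \<alpha> i)"
    unfolding weight_def by (simp add: sum_list_distinct_conv_sum_set)
  then show ?thesis using weight_dp_fold[OF assms[unfolded dp_monom_def]] by simp
qed

lemma dp_monom_eq_0:
  assumes "\<And>\<beta>. \<beta> \<in> Poly_Mapping.keys f \<Longrightarrow> weight \<beta> < weight \<alpha>"
  shows "dp_monom \<alpha> f = 0"
proof (rule ccontr)
  assume "dp_monom \<alpha> f \<noteq> 0"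
  then obtain \<gamma> where "\<gamma> \<in> Poly_Mapping.keys (dp_monom \<alpha> f)"
    by (auto simp: poly_mapping_eq_iff fun_eq_iff in_keys_iff)
  from weight_dp_monom[OF this] show False using assms by fastforce
qed

lemma finite_weight_le: "finite {\<alpha>. weight \<alpha> \<le> n}"
proof -
  have "{\<alpha>. weight \<alpha> \<le> n} \<subseteq> (\<lambda>g. Abs_poly_mapping g) `
      {g. (\<forall>i. (i \<in> {..n} \<longrightarrow> g i \<in> {..n}) \<and> (i \<notin> {..n} \<longrightarrow> g i = 0))}"
  proof
    fix \<alpha> assume a: "\<alpha> \<in> {\<alpha>. weight \<alpha> \<le> n}"
    have le: "Suc i * Poly_Mapping.lookup \<alpha> i \<le> n" for i
    proof (cases "i \<in> Poly_Mapping.keys \<alpha>")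
      case True
      then have "Suc i * Poly_Mapping.lookup \<alpha> i \<le> weight \<alpha>"
        unfolding weight_def by (intro member_le_sum) auto
      then show ?thesis using a by simp
    qed (auto simp: in_keys_iff)
    have 1: "Poly_Mapping.lookup \<alpha> i \<le> n" for i
      using le[of i] by simp
    have 2: "Poly_Mapping.lookup \<alpha> i = 0" if "i > n" for i
    proof (rule ccontr)
      assume "Poly_Mapping.lookup \<alpha> i \<noteq> 0"
      then have "Suc i * 1 \<le> Suc i * Poly_Mapping.lookup \<alpha> i" by (intro mult_le_mono2) auto
      then show False using le[of i] that by simp
    qed
    have "Poly_Mapping.lookup \<alpha> \<in> {g. (\<forall>i. (i \<in> {..n} \<longrightarrow> g i \<in> {..n}) \<and> (i \<notin> {..n} \<longrightarrow> g i = 0))}"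
      using 1 2 by auto
    then show "\<alpha> \<in> (\<lambda>g. Abs_poly_mapping g) `
      {g. (\<forall>i. (i \<in> {..n} \<longrightarrow> g i \<in> {..n}) \<and> (i \<notin> {..n} \<longrightarrow> g i = 0))}"
      by (rule image_eqI[rotated]) (simp add: lookup_inverse)
  qed
  moreover have "finite {g. (\<forall>i::nat. (i \<in> {..n} \<longrightarrow> g i \<in> {..n}) \<and> (i \<notin> {..n} \<longrightarrow> g i = 0))}"
    by (rule finite_set_of_finite_funs) auto
  ultimately show ?thesis by (meson finite_imageI finite_subset)
qed

lemma weight_bound:
  obtains M where "\<And>\<beta>. \<beta> \<in> Poly_Mapping.keys f \<Longrightarrow> weight \<beta> \<le> M"
  by (rule that[of "\<Sum>\<beta>\<in>Poly_Mapping.keys f. weight \<beta>"]) (auto intro: member_le_sum)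

lemma locally_finite_diff_op: "locally_finite UNIV (\<lambda>\<alpha> f. a \<alpha> * dp_monom \<alpha> f)"
  unfolding locally_finite_def
proof
  fix f :: kpoly
  obtain M where M: "\<And>\<beta>. \<beta> \<in> Poly_Mapping.keys f \<Longrightarrow> weight \<beta> \<le> M" using weight_bound by blast
  have "{\<alpha> \<in> UNIV. a \<alpha> * dp_monom \<alpha> f \<noteq> 0} \<subseteq> {\<alpha>. weight \<alpha> \<le> M}"
  proof (rule subsetI, rule ccontr)
    fix \<alpha> assume "\<alpha> \<in> {\<alpha> \<in> UNIV. a \<alpha> * dp_monom \<alpha> f \<noteq> 0}" "\<alpha> \<notin> {\<alpha>. weight \<alpha> \<le> M}"
    then show False using dp_monom_eq_0[of f \<alpha>] le_less_trans[OF M] by fastforce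
  qed
  then show "finite {\<alpha> \<in> UNIV. a \<alpha> * dp_monom \<alpha> f \<noteq> 0}"
    using finite_weight_le finite_subset by blast
qed

lemma locally_finite_E20:
  "locally_finite {1..} (\<lambda>k x. lift_op (\<lambda>f. cc (int k) * f) (dpi_op k x))"
  unfolding locally_finite_def
proof
  fix x :: superpoly
  have "{k \<in> {1..}. lift_op (\<lambda>f. cc (int k) * f) (dpi_op k x) \<noteq> 0} \<subseteq>
      Suc ` (\<Union>I\<in>Poly_Mapping.keys x. fset I)" (is "?A \<subseteq> ?B")
  proof
    fix k assume k: "k \<in> ?A"
    then have "dpi_op k x \<noteq> 0" by (auto simp: lift_op_def map_eq_zero_iff)
    then obtain I where "I \<in> Poly_Mapping.keys x" "k - 1 |\<in>| I"
      unfolding dpi_op_def by (elim sum.not_neutral_contains_not_neutral) (fastforce split: if_splits)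
    with k show "k \<in> ?B" by (intro image_eqI[of _ _ "k - 1"]) auto
  qed
  then show "finite {k \<in> {1..}. lift_op (\<lambda>f. cc (int k) * f) (dpi_op k x) \<noteq> 0}"
    by (rule finite_subset) auto
qed

definition graded :: "kpoly fps \<Rightarrow> bool" where
  "graded G \<longleftrightarrow> (\<forall>n. \<forall>\<alpha>\<in>Poly_Mapping.keys (fps_nth G n). weight \<alpha> = n)"

lemma keys_scal_mult: "Poly_Mapping.keys (scal a * f) \<subseteq> Poly_Mapping.keys f"
  using keys_mult[of "scal a" f] by (auto simp: scal_def split: if_splits)

lemma graded_mult:
  assumes "graded F" "graded G"
  shows "graded (F * G)"
  unfolding graded_def
proof (intro allI ballI)
  fix n \<alpha> assume "\<alpha> \<in> Poly_Mapping.keys (fps_nth (F * G) n)"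
  then obtain i where i: "i \<le> n" "\<alpha> \<in> Poly_Mapping.keys (fps_nth F i * fps_nth G (n - i))"
    unfolding fps_mult_nth using keys_sum by fastforce
  then obtain \<beta> \<gamma> where "\<alpha> = \<beta> + \<gamma>" "\<beta> \<in> Poly_Mapping.keys (fps_nth F i)"
      "\<gamma> \<in> Poly_Mapping.keys (fps_nth G (n - i))"
    using keys_mult by blast
  then show "weight \<alpha> = n" using assms i(1) by (simp add: graded_def weight_add)
qed

lemma graded_power:
  assumes "graded G"
  shows "graded (G ^ m)"
proof (induction m)
  case 0
  show ?case by (simp add: graded_def)
next
  case (Suc m)
  then show ?case using assms graded_mult by simp
qed

lemma graded_exp_compose:
  assumes "graded G"
  shows "graded (exp_series oo G)"
  unfolding graded_def
proof (intro allI ballI)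
  fix n \<alpha> assume "\<alpha> \<in> Poly_Mapping.keys (fps_nth (exp_series oo G) n)"
  then obtain i where "\<alpha> \<in> Poly_Mapping.keys (scal (1 / fact i) * fps_nth (G ^ i) n)"
    unfolding fps_compose_nth exp_series_def using keys_sum by fastforce
  then show "weight \<alpha> = n" using keys_scal_mult graded_power[OF assms] unfolding graded_def by blast
qed

lemma keys_var: "Poly_Mapping.keys (var k) = {Poly_Mapping.single (k - 1) 1}"
  by (simp add: var_def)

lemma graded_linear: "graded (Abs_fps (\<lambda>r. if r = 0 then 0 else scal (a r) * var r))"
proof -
  have "weight \<alpha> = r" if "r > 0" "\<alpha> \<in> Poly_Mapping.keys (scal (a r) * var r)" for r \<alpha>
    using that keys_scal_mult[of "a r" "var r"] by (auto simp: keys_var)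
  then show ?thesis by (simp add: graded_def)
qed

lemma graded_c_series: "graded c_series" and graded_ct_series: "graded ct_series"
  unfolding c_series_def ct_series_def by (rule graded_exp_compose[OF graded_linear])+

lemma ct_op_eq_0:
  assumes "\<And>\<beta>. \<beta> \<in> Poly_Mapping.keys f \<Longrightarrow> weight \<beta> < nat n"
  shows "ct_op n f = 0"
  using assms graded_ct_series
  by (auto simp: ct_op_def at_dp_def graded_def intro!: sum.neutral dp_monom_eq_0)

lemma locally_finite_F2m1:
  "locally_finite {1..} (\<lambda>k x. pi_op k (lift_op (ct_op (int k)) x))"
  unfolding locally_finite_def
proof
  fix x :: superpoly
  have "\<exists>M. \<forall>\<beta>\<in>Poly_Mapping.keys (Poly_Mapping.lookup x I). weight \<beta> \<le> M" for I
    using weight_bound by metis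
  then obtain M where M: "\<And>I \<beta>. \<beta> \<in> Poly_Mapping.keys (Poly_Mapping.lookup x I) \<Longrightarrow> weight \<beta> \<le> M I"
    by metis
  have "k \<le> (\<Sum>I\<in>Poly_Mapping.keys x. M I)" if "pi_op k (lift_op (ct_op (int k)) x) \<noteq> 0" for k
  proof (rule ccontr)
    assume k: "\<not> ?thesis"
    have "M I < k" if "I \<in> Poly_Mapping.keys x" for I
      using k that member_le_sum[of I "Poly_Mapping.keys x" M] by simp
    then have "lift_op (ct_op (int k)) x = 0"
      unfolding lift_op_def map_eq_zero_iff
      by (intro ballI ct_op_eq_0) (use M in fastforce)
    then show False using that by (simp add: pi_op_def)
  qed
  then have "{k \<in> {1..}. pi_op k (lift_op (ct_op (int k)) x) \<noteq> 0} \<subseteq> {..\<Sum>I\<in>Poly_Mapping.keys x. M I}"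
    by auto
  then show "finite {k \<in> {1..}. pi_op k (lift_op (ct_op (int k)) x) \<noteq> 0}"
    using finite_subset by blast
qed

declare One_nat_def [simp]

end

theory Submission
  imports Defs
begin

text \<open>Write \<open>a = 1/q\<close>. Moving \<open>\<partial>/\<partial>\<pi>_k\<close> past \<open>\<pi>_l\<close> in the anticommutator of
  \<open>E = \<Sum> c_k \<partial>/\<partial>\<pi>_k\<close> and \<open>F = - \<Sum> \<pi>_l c~_l\<close> gives
  \[ -[E, F]_+ = \sum_{k \ge 1} c_k \tilde c_k
       + \sum_{k, l \ge 1} [\tilde c_k, c_l]\, \pi_k \partial/\partial\pi_l , \]
  and \<open>(1 - t) D_2\<close> is this operator. Both claims are therefore about the two families of
  commuting operators \<open>c_l\<close> and \<open>c~_k\<close>.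

  Bilinearity. The series \<open>c~(z)\<close> acts on polynomials as the substitution
  \<open>p_n \<mapsto> p_n + (a^n - 1) z^{-n}\<close>, so it multiplies \<open>c(w)\<close> by
  \[ \exp\Big(\sum_n (a^n - 1)(1 - t^n) y^n / n\Big)
       = \frac{(1 - y)(1 - a t y)}{(1 - a y)(1 - t y)}, \qquad y = w/z . \]
  By partial fractions its coefficients are \<open>1\<close> for \<open>n = 0\<close> and
  \<open>(1 - t)(a - 1) [[n]]_{(a, t)}\<close> for \<open>n \<ge> 1\<close> (\<open>exchange_coeff_eq_qnum\<close>). The leading \<open>1\<close> cancels in
  the commutator, and what remains is \<open>Ctilde\<close> (\<open>ct_op_cc_mult\<close>, \<open>ct_op_cc_commutator\<close>).

  Comparison with the Hamiltonian. In \<open>N\<close> variables \<open>c(z)\<close> becomes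
  \<open>\<Prod>_i (1 - t x_i z)/(1 - x_i z)\<close>, whose partial fraction expansion is
  \<open>t^N + \<Sum>_i R_i/(1 - x_i z)\<close> with \<open>R_i = (1 - t) \<Prod>_{j \<noteq> i} (x_i - t x_j)/(x_i - x_j)\<close>. Pairing
  the coefficient of \<open>z^k\<close> with \<open>c~_k f\<close> turns \<open>1/(1 - x_i z)\<close> into the substitution \<open>c~\<close> at
  \<open>z^{-1} = x_i\<close>, which on power sums is the shift \<open>x_i \<mapsto> a x_i\<close>
  (\<open>shift_inv_power_sum_subst\<close>). Since \<open>c_0 c~_0 = 1\<close>, this yields
  \<open>power_sum_subst_eq_RM_inverted\<close>.

  Exponentials are handled through the linear recurrences given by their logarithmic
  derivatives, and an identity between series becomes an induction along the recurrence.
  An infinite sum of operators, applied to a given element, equals all its sufficiently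
  long partial sums; computing with eventual statements about the length \<open>M\<close> of the partial
  sum makes all rearrangements finite.

  The splitting into a bosonic and a fermionic part is unique: a normal ordered term with at
  least one \<open>\<pi>\<close> or \<open>\<partial>/\<partial>\<pi>\<close> sends a polynomial to an element without polynomial component, so
  the bosonic part can be read off from the action on polynomials.\<close>

section \<open>Expansions of rational functions\<close>

definition geo_fps :: "'a::comm_ring_1 \<Rightarrow> 'a fps" where
  "geo_fps c = Abs_fps (\<lambda>n. c ^ n)"

text \<open>The expansion of the rational function \<open>\<Prod>_i (1 - b_i X)/(1 - c_i X)\<close>.\<close>

definition ratio_fps :: "'i set \<Rightarrow> ('i \<Rightarrow> 'a) \<Rightarrow> ('i \<Rightarrow> 'a) \<Rightarrow> 'a::comm_ring_1 fps" where
  "ratio_fps I b c = (\<Prod>i\<in>I. (1 - fps_const (b i) * fps_X) * geo_fps (c i))"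

lemma geo_fps_nth [simp]: "fps_nth (geo_fps c) n = c ^ n"
  by (simp add: geo_fps_def)

lemma geo_fps_inverse: "(1 - fps_const c * fps_X) * geo_fps c = 1"
  by (rule fps_ext)
    (auto simp: left_diff_distrib mult.assoc fps_X_mult_nth power_eq_if)

text \<open>With \<open>Y = 1/(1 - c X)\<close> one has \<open>Y' = c Y\<^sup>2\<close> and \<open>c X Y = Y - 1\<close>.\<close>

lemma geo_fps_deriv: "fps_X * fps_deriv (geo_fps c) = geo_fps c * (geo_fps c - 1)"
proof -
  let ?Y = "geo_fps c" and ?c = "fps_const c"
  have inv: "(1 - ?c * fps_X) * ?Y = 1" by (rule geo_fps_inverse)
  have "fps_deriv ((1 - ?c * fps_X) * ?Y) = 0" by (simp only: inv fps_deriv_1)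
  then have "(1 - ?c * fps_X) * fps_deriv ?Y = ?c * ?Y" by (simp add: algebra_simps)
  then have D: "(1 - ?c * fps_X) * fps_deriv ?Y = ?c * ?Y" by (simp add: algebra_simps)
  have "fps_X * fps_deriv ?Y = fps_X * (((1 - ?c * fps_X) * ?Y) * fps_deriv ?Y)"
    by (simp add: inv)
  also have "\<dots> = ?Y * (fps_X * ((1 - ?c * fps_X) * fps_deriv ?Y))"
    by (simp only: mult_ac)
  also have "\<dots> = ?Y * (?Y - (1 - ?c * fps_X) * ?Y)"
    unfolding D by (simp add: algebra_simps)
  also have "\<dots> = ?Y * (?Y - 1)" by (simp only: inv)
  finally show ?thesis .
qed

text \<open>The logarithmic derivative of a product is the sum of those of its factors, and
  \<open>X d/dX\<close> of \<open>log (1 - b X) - log (1 - c X)\<close> has coefficients \<open>c^r - b^r\<close>.\<close>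

lemma ratio_fps_deriv:
  assumes "finite I"
  shows "fps_X * fps_deriv (ratio_fps I b c) =
    ratio_fps I b c * Abs_fps (\<lambda>r. \<Sum>i\<in>I. c i ^ r - b i ^ r)"
  using assms
proof (induction I rule: finite_induct)
  case empty
  show ?case by (simp add: ratio_fps_def fps_zero_def[symmetric])
next
  case (insert n I)
  let ?Y = "geo_fps (c n)" and ?Z = "geo_fps (b n)" and ?b = "fps_const (b n)"
  let ?W = "(1 - ?b * fps_X) * ?Y"
  let ?S = "Abs_fps (\<lambda>r. \<Sum>i\<in>I. c i ^ r - b i ^ r)"
  have Z: "(1 - ?b * fps_X) * ?Z = 1" by (rule geo_fps_inverse)
  have "fps_X * fps_deriv ?W = - ?b * fps_X * ?Y + (1 - ?b * fps_X) * (fps_X * fps_deriv ?Y)"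
    by (simp add: algebra_simps flip: fps_const_neg)
  also have "\<dots> = ?W * ?Y - ?Y * ((1 - ?b * fps_X) * ?Z)"
    unfolding geo_fps_deriv Z by (simp add: algebra_simps flip: fps_const_neg)
  also have "\<dots> = ?W * (?Y - ?Z)"
    by (simp add: algebra_simps)
  finally have W: "fps_X * fps_deriv ?W = ?W * (?Y - ?Z)" .
  have S: "Abs_fps (\<lambda>r. \<Sum>i\<in>insert n I. c i ^ r - b i ^ r) = (?Y - ?Z) + ?S"
    by (rule fps_ext) (use insert in simp)
  have P: "ratio_fps (insert n I) b c = ?W * ratio_fps I b c"
    using insert by (simp add: ratio_fps_def)
  have "fps_X * fps_deriv (?W * ratio_fps I b c) =
      (fps_X * fps_deriv ?W) * ratio_fps I b c + ?W * (fps_X * fps_deriv (ratio_fps I b c))"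
    by (simp add: algebra_simps)
  also have "\<dots> = ?W * ratio_fps I b c * ((?Y - ?Z) + ?S)"
    unfolding W insert.IH by (simp only: algebra_simps)
  finally show ?case unfolding P S .
qed

text \<open>Together with the constant coefficient 1 this determines the series in characteristic zero;
  it is how series defined by exponentials are recognised as rational functions.\<close>

lemma ratio_fps_recurrence:
  assumes "finite I"
  shows "of_nat k * fps_nth (ratio_fps I b c) k =
    (\<Sum>r=1..k. (\<Sum>i\<in>I. c i ^ r - b i ^ r) * fps_nth (ratio_fps I b c) (k - r))"
proof -
  let ?s = "\<lambda>r. \<Sum>i\<in>I. c i ^ r - b i ^ r"
  have "of_nat k * fps_nth (ratio_fps I b c) k = fps_nth (fps_X * fps_deriv (ratio_fps I b c)) k"
    by (cases k) (simp_all del: of_nat_Suc)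
  also have "\<dots> = fps_nth (Abs_fps ?s * ratio_fps I b c) k"
    by (simp add: ratio_fps_deriv assms mult.commute)
  also have "\<dots> = (\<Sum>r=0..k. ?s r * fps_nth (ratio_fps I b c) (k - r))"
    by (simp add: fps_mult_nth)
  also have "\<dots> = (\<Sum>r=1..k. ?s r * fps_nth (ratio_fps I b c) (k - r))"
    by (rule sum.mono_neutral_right) (auto simp: Suc_le_eq)
  finally show ?thesis .
qed

lemma ratio_fps_nth_0:  "fps_nth (ratio_fps I b c) 0 = 1"
proof (cases "finite I")
  case True
  then show ?thesis
    by (induction I rule: finite_induct) (simp_all add: ratio_fps_def)
qed (simp add: ratio_fps_def)

text \<open>The coefficient of \<open>1/(1 - c_i X)\<close> in the partial fraction expansion of
  \<open>\<Prod>_i (1 - b_i X)/(1 - c_i X)\<close>.\<close>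

definition residue_coeff :: "'i set \<Rightarrow> ('i \<Rightarrow> 'a) \<Rightarrow> ('i \<Rightarrow> 'a) \<Rightarrow> 'i \<Rightarrow> 'a::field" where
  "residue_coeff I b c i = (c i - b i) / c i * (\<Prod>j\<in>I - {i}. (c i - b j) / (c i - c j))"

lemma residue_coeff_insert:
  assumes "finite I" "n \<notin> I" "i \<in> I"
  shows "residue_coeff (insert n I) b c i = residue_coeff I b c i * ((c i - b n) / (c i - c n))"
proof -
  have "insert n I - {i} = insert n (I - {i})" using assms by auto
  then show ?thesis using assms by (simp add: residue_coeff_def mult_ac)
qed

text \<open>The partial fraction expansion evaluated at \<open>X = 1/x\<close>. A further factor
  \<open>(x - b_n)/(x - c_n)\<close> is distributed over the existing fractions; the new fraction with pole
  \<open>c_n\<close> then collects the whole previous expansion evaluated at \<open>c_n\<close>, which is the previous product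
  by the induction hypothesis at that point. For this reason the point is arbitrary in the
  induction.\<close>

lemma partial_fractions_at_point:
  fixes b c :: "'i \<Rightarrow> 'a::field"
  assumes "finite I" "inj_on c I" "\<And>i. i \<in> I \<Longrightarrow> c i \<noteq> 0" "x \<notin> c ` I"
  shows "(\<Prod>j\<in>I. (x - b j) / (x - c j)) =
    (\<Prod>j\<in>I. b j / c j) + (\<Sum>i\<in>I. residue_coeff I b c i * (x / (x - c i)))"
  using assms
proof (induction I arbitrary: x rule: finite_induct)
  case (insert n I)
  let ?B = "\<Prod>j\<in>I. b j / c j" and ?R = "residue_coeff I b c"
  have IH: "(\<Prod>j\<in>I. (y - b j) / (y - c j)) = ?B + (\<Sum>i\<in>I. ?R i * (y / (y - c i)))"
    if "y \<notin> c ` I" for y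
    using insert.prems that by (intro insert.IH) auto
  have n: "c n \<noteq> 0" "c n \<notin> c ` I" "x \<noteq> c n" "x \<notin> c ` I" using insert by auto
  have Rn: "residue_coeff (insert n I) b c n =
      (c n - b n) / c n * (?B + (\<Sum>i\<in>I. ?R i * (c n / (c n - c i))))"
    using insert.hyps unfolding residue_coeff_def[of "insert n I"] IH[OF n(2), symmetric] by simp
  have 1: "(x - b n) / (x - c n) * ?B = b n / c n * ?B + (c n - b n) / c n * ?B * (x / (x - c n))"
    using n by (simp add: field_simps)
  have 2: "(x - b n) / (x - c n) * (?R i * (x / (x - c i))) =
      residue_coeff (insert n I) b c i * (x / (x - c i)) +
      (c n - b n) / c n * (?R i * (c n / (c n - c i))) * (x / (x - c n))" if "i \<in> I" for i
  proof -
    have "c i \<noteq> c n" using n(2) that by (metis imageI)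
    then have nz: "x - c i \<noteq> 0" "x - c n \<noteq> 0" "c n - c i \<noteq> 0" "c i - c n \<noteq> 0"
      using n that by auto
    have "(x - b n) / (x - c n) * (x / (x - c i)) = (c i - b n) / (c i - c n) * (x / (x - c i)) +
      (c n - b n) / (c n - c i) * (x / (x - c n))"
    proof -
      have "(c i - b n) / (c i - c n) = (b n - c i) / (c n - c i)"
        using nz by (simp add: divide_simps) (simp add: algebra_simps)
      then show ?thesis using nz by (simp add: divide_simps) (simp add: algebra_simps)
    qed
    then have "(x - b n) / (x - c n) * (?R i * (x / (x - c i))) =
      ?R i * ((c i - b n) / (c i - c n) * (x / (x - c i)) +
      (c n - b n) / (c n - c i) * (x / (x - c n)))"
      by (simp only: mult.left_commute[of _ "?R i"])
    also have "(c n - b n) / (c n - c i) = (c n - b n) / c n * (c n / (c n - c i))"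
      using n(1) by simp
    finally show ?thesis
      by (simp only: residue_coeff_insert[OF insert.hyps that] distrib_left mult_ac)
  qed
  have "(\<Prod>j\<in>insert n I. (x - b j) / (x - c j)) =
      (x - b n) / (x - c n) * (?B + (\<Sum>i\<in>I. ?R i * (x / (x - c i))))"
    using insert.hyps IH[OF n(4)] by simp
  also have "\<dots> = b n / c n * ?B + (c n - b n) / c n * ?B * (x / (x - c n)) +
      (\<Sum>i\<in>I. residue_coeff (insert n I) b c i * (x / (x - c i)) +
      (c n - b n) / c n * (?R i * (c n / (c n - c i))) * (x / (x - c n)))"
    unfolding distrib_left 1 sum_distrib_left by (simp only: 2 cong: sum.cong)
  also have "\<dots> = b n / c n * ?B + (\<Sum>i\<in>I. residue_coeff (insert n I) b c i * (x / (x - c i))) +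
     residue_coeff (insert n I) b c n * (x / (x - c n))"
    unfolding Rn by (simp add: sum.distrib sum_distrib_left sum_distrib_right algebra_simps)
  finally show ?case using insert.hyps by (simp add: add_ac)
qed simp

text \<open>The same distribution step, now between power series; the coefficient of the new pole is
  still summed up by the pointwise expansion at \<open>c_n\<close>.\<close>

lemma ratio_fps_partial_fractions:
  fixes b c :: "'i \<Rightarrow> 'a::field"
  assumes "finite I" "inj_on c I" "\<And>i. i \<in> I \<Longrightarrow> c i \<noteq> 0"
  shows "ratio_fps I b c = fps_const (\<Prod>j\<in>I. b j / c j) +
    (\<Sum>i\<in>I. fps_const (residue_coeff I b c i) * geo_fps (c i))"
  using assms
proof (induction I rule: finite_induct)
  case empty
  show ?case by (simp add: ratio_fps_def)
next
  case (insert n I)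
  let ?B = "\<Prod>j\<in>I. b j / c j" and ?R = "residue_coeff I b c" and ?R' = "residue_coeff (insert n I) b c"
  let ?Yn = "geo_fps (c n)" and ?Y = "\<lambda>i. geo_fps (c i)"
  let ?W = "(1 - fps_const (b n) * fps_X) * ?Yn"
  have n: "c n \<noteq> 0" "c n \<notin> c ` I" using insert by auto
  have Rn: "?R' n = (c n - b n) / c n * (?B + (\<Sum>i\<in>I. ?R i * (c n / (c n - c i))))"
    using insert.hyps insert.prems partial_fractions_at_point[OF insert.hyps(1) _ _ n(2), of b]
    unfolding residue_coeff_def[of "insert n I"] by simp
  have W: "?W = fps_const (b n / c n) + fps_const ((c n - b n) / c n) * ?Yn"
  proof (rule fps_ext)
    fix m
    show "fps_nth ?W m = fps_nth (fps_const (b n / c n) + fps_const ((c n - b n) / c n) * ?Yn) m"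
      using n(1) by (cases m) (simp_all add: left_diff_distrib mult.assoc fps_X_mult_nth field_simps)
  qed
  have YY: "?Yn * ?Y i = fps_const (c n / (c n - c i)) * ?Yn + fps_const (c i / (c i - c n)) * ?Y i"
    if "i \<in> I" for i
  proof -
    have "c i \<noteq> c n" using n(2) that by (metis imageI)
    then have nz: "c n - c i \<noteq> 0" using n that by auto
    have "fps_const (c n - c i) * (?Yn * ?Y i) = fps_const (c n) * ?Yn - fps_const (c i) * ?Y i"
      using geo_fps_inverse[of "c n"] geo_fps_inverse[of "c i"]
      unfolding fps_const_sub[symmetric] by algebra
    then have "?Yn * ?Y i = fps_const (inverse (c n - c i)) *
        (fps_const (c n) * ?Yn - fps_const (c i) * ?Y i)"
      using nz by (metis (no_types, lifting) fps_const_mult fps_const_1_eq_1 left_inverse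
          mult.assoc mult_1)
    also have "\<dots> = fps_const (inverse (c n - c i) * c n) * ?Yn -
        fps_const (inverse (c n - c i) * c i) * ?Y i"
      by (simp only: fps_const_mult[symmetric] right_diff_distrib mult.assoc)
    also have "\<dots> = fps_const (inverse (c n - c i) * c n) * ?Yn +
        fps_const (- (inverse (c n - c i) * c i)) * ?Y i"
      by (simp flip: fps_const_neg)
    also have "inverse (c n - c i) * c n = c n / (c n - c i)"
      by (simp add: divide_inverse)
    also have "- (inverse (c n - c i) * c i) = c i / (c i - c n)"
      using nz by (simp add: field_simps)
    finally show ?thesis .
  qed
  have 2: "?W * (fps_const (?R i) * ?Y i) = fps_const (?R' i) * ?Y i +
      fps_const ((c n - b n) / c n * (?R i * (c n / (c n - c i)))) * ?Yn" if "i \<in> I" for i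
  proof -
    have "c i \<noteq> c n" using n(2) that by (metis imageI)
    then have nz: "c i - c n \<noteq> 0" using n that by auto
    have "?W * (fps_const (?R i) * ?Y i) = fps_const (?R i * (b n / c n)) * ?Y i +
       fps_const (?R i * ((c n - b n) / c n)) * (?Yn * ?Y i)"
      unfolding W by (simp only: fps_const_mult[symmetric] algebra_simps)
    also have "\<dots> = fps_const (?R i * (b n / c n + (c n - b n) / c n * (c i / (c i - c n)))) * ?Y i
       + fps_const ((c n - b n) / c n * (?R i * (c n / (c n - c i)))) * ?Yn"
      unfolding YY[OF that] by (simp only: fps_const_mult[symmetric] fps_const_add[symmetric] algebra_simps)
    also have "b n / c n + (c n - b n) / c n * (c i / (c i - c n)) = (c i - b n) / (c i - c n)"
      using nz n(1) by (simp add: divide_simps) (simp add: algebra_simps)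
    finally show ?thesis using insert.hyps that by (simp add: residue_coeff_insert)
  qed
  have "ratio_fps (insert n I) b c = ?W * ratio_fps I b c"
    using insert.hyps by (simp add: ratio_fps_def)
  also have "ratio_fps I b c = fps_const ?B + (\<Sum>i\<in>I. fps_const (?R i) * ?Y i)"
    using insert by auto
  also have "?W * (fps_const ?B + (\<Sum>i\<in>I. fps_const (?R i) * ?Y i)) =
      ?W * fps_const ?B + (\<Sum>i\<in>I. fps_const (?R' i) * ?Y i +
      fps_const ((c n - b n) / c n * (?R i * (c n / (c n - c i)))) * ?Yn)"
    unfolding distrib_left sum_distrib_left by (simp add: 2)
  also have "\<dots> = fps_const (b n / c n * ?B) + fps_const (?R' n) * ?Yn +
       (\<Sum>i\<in>I. fps_const (?R' i) * ?Y i)"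
  proof -
    have const_sum: "fps_const (sum g I) = (\<Sum>i\<in>I. fps_const (g i))" for g :: "'i \<Rightarrow> 'a"
      by (rule fps_ext) (simp add: fps_sum_nth)
    have "(\<Sum>i\<in>I. fps_const ((c n - b n) / c n * (?R i * (c n / (c n - c i)))) * ?Yn) =
      fps_const ((c n - b n) / c n * (\<Sum>i\<in>I. ?R i * (c n / (c n - c i)))) * ?Yn"
      by (simp add: sum_distrib_left sum_distrib_right const_sum flip: fps_const_mult)
    then show ?thesis
      unfolding Rn W sum.distrib
      by (simp only: fps_const_mult[symmetric] fps_const_add[symmetric] algebra_simps)
  qed
  finally show ?case using insert.hyps by (simp add: add_ac)
qed

section \<open>Polynomials, derivatives and evaluation at derivatives\<close>

text \<open>Index bounds are kept in the form \<open>1 \<le> k\<close> in which they occur in the operators.\<close>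

declare One_nat_def [simp del]

lemma scal_0 [simp]: "scal 0 = 0"
  by (simp add: scal_def)

lemma scal_1 [simp]: "scal 1 = 1"
  by (simp add: scal_def)

lemma scal_add: "scal (a + b) = scal a + scal b"
  by (simp add: scal_def single_add)

lemma scal_diff: "scal (a - b) = scal a - scal b"
  by (simp add: scal_def single_diff)

lemma scal_mult: "scal (a * b) = scal a * scal b"
  by (simp add: scal_def mult_single)

lemma scal_of_nat [simp]: "scal (of_nat n) = of_nat n"
  by (simp add: scal_def)

lemma scal_sum: "scal (sum g A) = (\<Sum>i\<in>A. scal (g i))"
  by (induction A rule: infinite_finite_induct) (simp_all add: scal_add)

lemma scal_mult_left: "scal a * (scal b * f) = scal (a * b) * f"
  by (simp add: scal_mult mult.assoc)

lemma scal_mult_single: "scal a * Poly_Mapping.single \<alpha> b = Poly_Mapping.single \<alpha> (a * b)"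
  by (simp add: scal_def mult_single)

lemma var_mult_single:
  "var (Suc i) * Poly_Mapping.single \<alpha> a = Poly_Mapping.single (Poly_Mapping.single i 1 + \<alpha>) a"
  by (simp add: var_def mult_single)

lemma kpoly_induct_monomials:
  fixes f :: kpoly
  assumes "\<And>\<alpha> a. P (Poly_Mapping.single \<alpha> a)" "\<And>f g. P f \<Longrightarrow> P g \<Longrightarrow> P (f + g)"
  shows "P f"
proof (induction f rule: update_induct)
  case const
  show ?case using assms(1)[of 0 0] by simp
next
  case (update f \<alpha> a)
  have "Poly_Mapping.update \<alpha> a f = f + Poly_Mapping.single \<alpha> a"
    using update(1) by (intro poly_mapping_eqI)
      (auto simp: lookup_update lookup_add lookup_single when_def in_keys_iff)
  then show ?case using update(3) assms by simp
qed

lemma exponent_split: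
  fixes \<alpha> :: "nat \<Rightarrow>\<^sub>0 nat"
  assumes "i \<in> Poly_Mapping.keys \<alpha>"
  shows "Poly_Mapping.single i 1 + (\<alpha> - Poly_Mapping.single i 1) = \<alpha>"
  using assms
  by (intro poly_mapping_eqI) (auto simp: lookup_add lookup_minus lookup_single when_def in_keys_iff)

text \<open>Additive identities that are compatible with multiplication by a single variable hold
  everywhere once they hold for constants; substitutions and differential operators are
  compared with this rule.\<close>

lemma kpoly_induct [case_names scal add var]:
  fixes f :: kpoly
  assumes scal: "\<And>a. P (scal a)" and add: "\<And>f g. P f \<Longrightarrow> P g \<Longrightarrow> P (f + g)"
    and var: "\<And>r f. r \<ge> 1 \<Longrightarrow> P f \<Longrightarrow> P (var r * f)"
  shows "P f"
proof (rule kpoly_induct_monomials)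
  fix \<alpha> :: "nat \<Rightarrow>\<^sub>0 nat" and a
  show "P (Poly_Mapping.single \<alpha> a)"
  proof (induction \<alpha> rule: measure_induct_rule[where f = weight])
    case (less \<alpha>)
    show ?case
    proof (cases "Poly_Mapping.keys \<alpha> = {}")
      case True
      then have "\<alpha> = 0" by (intro poly_mapping_eqI) (auto simp: in_keys_iff)
      then show ?thesis using scal[of a] by (simp add: scal_def)
    next
      case False
      then obtain i where i: "i \<in> Poly_Mapping.keys \<alpha>" by blast
      define \<beta> where "\<beta> = \<alpha> - Poly_Mapping.single i 1"
      have \<alpha>: "\<alpha> = Poly_Mapping.single i 1 + \<beta>" using exponent_split[OF i] by (simp add: \<beta>_def)
      have "weight \<beta> < weight \<alpha>" unfolding \<alpha> by (simp add: weight_add)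
      from var[OF _ less.IH[OF this], of "Suc i"] show ?thesis
        unfolding \<alpha> by (simp add: var_mult_single)
    qed
  qed
qed (rule add)

lemma dp_add: "dp k (f + g) = dp k f + dp k g"
  unfolding dp_def
  by (rule setsum_keys_plus_distrib) (simp_all add: distrib_left single_add)

lemma dp_single: "dp (Suc j) (Poly_Mapping.single \<alpha> a) =
    Poly_Mapping.single (\<alpha> - Poly_Mapping.single j 1) (of_nat (Poly_Mapping.lookup \<alpha> j) * a)"
  by (cases "a = 0") (simp_all add: dp_def)

lemma dp_0 [simp]: "dp k 0 = 0"
  by (simp add: dp_def)

lemma dp_scal_mult:
  assumes "k \<ge> 1"
  shows "dp k (scal a * f) = scal a * dp k f"
proof -
  obtain j where k: "k = Suc j" using assms by (cases k) auto
  show ?thesis unfolding k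
    by (induction f rule: kpoly_induct_monomials)
      (simp_all add: dp_add dp_single scal_mult_single distrib_left mult_ac)
qed

lemma dp_scal [simp]:
  assumes "k \<ge> 1"
  shows "dp k (scal a) = 0"
  using assms by (cases k) (simp_all add: scal_def dp_single)

lemma dp_var_mult:
  assumes "k \<ge> 1" "r \<ge> 1"
  shows "dp k (var r * f) = var r * dp k f + (if k = r then f else 0)"
proof -
  obtain j i where k: "k = Suc j" and r: "r = Suc i" using assms by (cases k; cases r) auto
  show ?thesis unfolding k r
  proof (induction f rule: kpoly_induct_monomials)
    case (1 \<alpha> a)
    show ?case
    proof (cases "j \<in> Poly_Mapping.keys \<alpha>")
      case True
      define \<beta> where "\<beta> = \<alpha> - Poly_Mapping.single j 1"
      have \<alpha>: "\<alpha> = Poly_Mapping.single j 1 + \<beta>" using exponent_split[OF True] by (simp add: \<beta>_def)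
      have "Poly_Mapping.single i 1 + (Poly_Mapping.single j 1 + \<beta>) - Poly_Mapping.single j 1 =
         Poly_Mapping.single i 1 + \<beta>"
        by (intro poly_mapping_eqI) (simp add: lookup_add lookup_minus)
      then show ?thesis unfolding \<alpha>
        by (auto simp: var_mult_single dp_single lookup_add lookup_single when_def
           distrib_right simp flip: single_add)
    next
      case False
      then show ?thesis
        by (auto simp: var_mult_single dp_single lookup_add lookup_single when_def in_keys_iff)
    qed
  qed (auto simp: dp_add distrib_left)
qed

lemma dp_commute:
  assumes "k \<ge> 1" "l \<ge> 1"
  shows "dp k (dp l f) = dp l (dp k f)"
  by (induction f rule: kpoly_induct) (auto simp: assms dp_add dp_var_mult)

lemma comp_fun_commute_dp: "comp_fun_commute (\<lambda>i. dp (Suc i) ^^ n i)"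
proof
  fix i j
  have 1: "dp (Suc i) ((dp (Suc j) ^^ n) f) = (dp (Suc j) ^^ n) (dp (Suc i) f)" for i j n f
    by (induction n) (simp_all add: dp_commute[of "Suc i" "Suc j"])
  have "(dp (Suc i) ^^ m) ((dp (Suc j) ^^ n) f) = (dp (Suc j) ^^ n) ((dp (Suc i) ^^ m) f)" for m n f
    by (induction m) (auto simp: 1)
  then show "(dp (Suc i) ^^ n i) \<circ> (dp (Suc j) ^^ n j) = (dp (Suc j) ^^ n j) \<circ> (dp (Suc i) ^^ n i)"
    by (simp add: fun_eq_iff)
qed

text \<open>Since the derivatives commute, the order of the variables may be forgotten; this makes it
  possible to insert a variable that does not yet occur in the exponent.\<close>

lemma dp_monom_eq_fold:
  "dp_monom \<alpha> f = Finite_Set.fold (\<lambda>i. dp (Suc i) ^^ Poly_Mapping.lookup \<alpha> i) f (Poly_Mapping.keys \<alpha>)"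
proof -
  interpret comp_fun_commute "\<lambda>i. dp (Suc i) ^^ Poly_Mapping.lookup \<alpha> i"
    by (rule comp_fun_commute_dp)
  show ?thesis
    using fold_set_fold_remdups[of f "sorted_list_of_set (Poly_Mapping.keys \<alpha>)"]
    by (simp add: dp_monom_def distinct_remdups_id)
qed

lemma dp_monom_0 [simp]: "dp_monom 0 f = f"
  by (simp add: dp_monom_def)

lemma dp_monom_zero [simp]: "dp_monom \<alpha> 0 = 0"
  by (rule dp_monom_eq_0) simp

lemma dp_monom_Suc: "dp_monom (Poly_Mapping.single i 1 + \<alpha>) f = dp (Suc i) (dp_monom \<alpha> f)"
proof -
  let ?\<beta> = "Poly_Mapping.single i 1 + \<alpha>"
  let ?F = "\<lambda>i. dp (Suc i) ^^ Poly_Mapping.lookup \<alpha> i"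
  let ?G = "\<lambda>i. dp (Suc i) ^^ Poly_Mapping.lookup ?\<beta> i"
  let ?K = "insert i (Poly_Mapping.keys \<alpha>)"
  interpret F: comp_fun_commute ?F by (rule comp_fun_commute_dp)
  interpret G: comp_fun_commute ?G by (rule comp_fun_commute_dp)
  have K: "Poly_Mapping.keys ?\<beta> = ?K"
    by (auto simp: in_keys_iff lookup_add lookup_single when_def split: if_splits)
  have F: "dp_monom \<alpha> f = Finite_Set.fold ?F f ?K"
  proof (cases "i \<in> Poly_Mapping.keys \<alpha>")
    case False
    then show ?thesis by (simp add: dp_monom_eq_fold in_keys_iff)
  qed (simp add: dp_monom_eq_fold insert_absorb)
  have "dp_monom ?\<beta> f = ?G i (Finite_Set.fold ?G f (?K - {i}))"
    unfolding dp_monom_eq_fold K by (rule G.fold_rec) auto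
  also have "Finite_Set.fold ?G f (?K - {i}) = Finite_Set.fold ?F f (?K - {i})"
    using comp_fun_commute_dp[unfolded comp_fun_commute_def']
    by (intro Finite_Set.fold_cong[of UNIV]) (auto simp: lookup_add lookup_single)
  also have "?G i (Finite_Set.fold ?F f (?K - {i})) = dp (Suc i) (?F i (Finite_Set.fold ?F f (?K - {i})))"
    by (simp add: lookup_add One_nat_def)
  also have "?F i (Finite_Set.fold ?F f (?K - {i})) = Finite_Set.fold ?F f ?K"
    by (rule F.fold_rec[symmetric]) auto
  finally show ?thesis unfolding F .
qed

lemma at_dp_add: "at_dp (P + Q) f = at_dp P f + at_dp Q f"
  unfolding at_dp_def
  by (rule setsum_keys_plus_distrib) (simp_all add: distrib_right scal_add)

lemma at_dp_0 [simp]: "at_dp 0 f = 0"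
  by (simp add: at_dp_def)

lemma at_dp_sum: "at_dp (sum P S) f = (\<Sum>i\<in>S. at_dp (P i) f)"
  by (induction S rule: infinite_finite_induct) (simp_all add: at_dp_add)

lemma at_dp_single: "at_dp (Poly_Mapping.single \<alpha> a) f = scal a * dp_monom \<alpha> f"
  by (simp add: at_dp_def)

lemma at_dp_scal: "at_dp (scal a) f = scal a * f"
  unfolding scal_def[of a] at_dp_single by (simp add: scal_def)

lemma at_dp_scal_mult: "at_dp (scal a * P) f = scal a * at_dp P f"
  by (induction P rule: kpoly_induct_monomials)
    (simp_all add: at_dp_add at_dp_single scal_mult_single distrib_left scal_mult mult_ac)

text \<open>Evaluation at the derivatives turns products of polynomials into compositions of
  operators; products with one variable generate the general case.\<close>

lemma at_dp_var_mult:
  assumes "r \<ge> 1"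
  shows "at_dp (var r * P) f = dp r (at_dp P f)"
proof -
  obtain i where r: "r = Suc i" using assms by (cases r) auto
  show ?thesis unfolding r
    by (induction P rule: kpoly_induct_monomials)
      (simp_all only: at_dp_add at_dp_single var_mult_single distrib_left dp_add dp_monom_Suc
        dp_scal_mult[of "Suc i", simplified])
qed

lemma at_dp_add_right: "at_dp P (f + g) = at_dp P f + at_dp P g"
  by (induction P rule: kpoly_induct)
    (simp_all add: at_dp_scal at_dp_add at_dp_var_mult dp_add distrib_left)

lemma at_dp_scal_right: "at_dp P (scal a * f) = scal a * at_dp P f"
  by (induction P rule: kpoly_induct)
    (simp_all add: at_dp_scal at_dp_add at_dp_var_mult dp_scal_mult distrib_left mult.left_commute)

section \<open>Recurrences for the two generating series\<close>

lemma exp_series_deriv: "fps_deriv exp_series = exp_series"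
proof (rule fps_ext)
  fix n
  have "of_nat (Suc n) * scal (1 / fact (Suc n)) = scal (1 / fact n)"
    by (simp del: of_nat_Suc add: fact_Suc flip: scal_of_nat scal_mult)
  then show "fps_nth (fps_deriv exp_series) n = fps_nth exp_series n"
    by (simp add: exp_series_def One_nat_def del: of_nat_Suc)
qed

text \<open>Coefficientwise form of \<open>X S' = (X L') S\<close> for \<open>S = exp L\<close> with linear exponent
  \<open>L = \<Sum> a_r var_r X^r\<close>.\<close>

lemma exp_series_recurrence:
  fixes a :: "nat \<Rightarrow> coeff_field"
  defines "S \<equiv> exp_series oo Abs_fps (\<lambda>r. if r = 0 then 0 else scal (a r) * var r)"
  shows "of_nat k * fps_nth S k = (\<Sum>r=1..k. scal (of_nat r * a r) * (var r * fps_nth S (k - r)))"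
    and "fps_nth S 0 = 1"
proof -
  let ?L = "Abs_fps (\<lambda>r. if r = 0 then 0 else scal (a r) * var r)"
  have "fps_X * fps_deriv S = (fps_X * fps_deriv ?L) * S"
    unfolding S_def by (subst fps_compose_deriv) (simp_all add: exp_series_deriv mult_ac)
  then have ode: "fps_nth (fps_X * fps_deriv S) k = fps_nth ((fps_X * fps_deriv ?L) * S) k"
    by (rule arg_cong)
  have L: "fps_nth (fps_X * fps_deriv ?L) r = scal (of_nat r * a r) * var r" for r
    by (cases r) (simp_all add: One_nat_def scal_mult mult.assoc del: of_nat_Suc)
  have "of_nat k * fps_nth S k = fps_nth (fps_X * fps_deriv S) k"
    by (cases k) (simp_all add: One_nat_def del: of_nat_Suc)
  also have "\<dots> = (\<Sum>r=0..k. scal (of_nat r * a r) * (var r * fps_nth S (k - r)))"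
    unfolding ode fps_mult_nth[of "fps_X * fps_deriv ?L"] L by (simp only: mult.assoc)
  also have "\<dots> = (\<Sum>r=1..k. scal (of_nat r * a r) * (var r * fps_nth S (k - r)))"
    by (rule sum.mono_neutral_right) (auto simp: Suc_le_eq One_nat_def)
  finally show "of_nat k * fps_nth S k =
     (\<Sum>r=1..k. scal (of_nat r * a r) * (var r * fps_nth S (k - r)))" .
  show "fps_nth S 0 = 1" by (simp add: S_def exp_series_def)
qed

lemma cc_neg [simp]: "n < 0 \<Longrightarrow> cc n = 0"
  by (simp add: cc_def)

lemma cc_0 [simp]: "cc 0 = 1"
  using exp_series_recurrence(2) by (simp add: cc_def c_series_def)

lemma ct_op_neg [simp]: "n < 0 \<Longrightarrow> ct_op n f = 0"
  by (simp add: ct_op_def)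

lemma ct_op_0 [simp]: "ct_op 0 f = f"
proof -
  have "fps_nth ct_series 0 = scal 1"
    using exp_series_recurrence(2) by (simp add: ct_series_def)
  then have "ct_op 0 f = at_dp (scal 1) f" by (simp add: ct_op_def)
  then show ?thesis unfolding at_dp_scal by simp
qed

lemma ct_op_add: "ct_op n (f + g) = ct_op n f + ct_op n g"
  by (simp add: ct_op_def at_dp_add_right)

lemma ct_op_scal_mult: "ct_op n (scal a * f) = scal a * ct_op n f"
  by (simp add: ct_op_def at_dp_scal_right)

lemma ct_op_zero [simp]: "ct_op n 0 = 0"
  using ct_op_scal_mult[of n 0 0] by simp

lemma ct_op_sum: "ct_op n (sum g S) = (\<Sum>i\<in>S. ct_op n (g i))"
  by (induction S rule: infinite_finite_induct) (simp_all add: ct_op_add)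

text \<open>Any bound \<open>K \<ge> n\<close> may be used, and negative \<open>n\<close> are allowed: the extra terms vanish. This
  uniformity lets recurrences with different indices be added under one sum.\<close>

lemma cc_recurrence:
  assumes "n \<le> int K"
  shows "of_int n * cc n = (\<Sum>r=1..K. scal (1 - tt ^ r) * (var r * cc (n - int r)))"
proof (cases "n < 0")
  case False
  define k where "k = nat n"
  have n: "n = int k" using False by (simp add: k_def)
  have "of_int n * cc n = of_nat k * fps_nth c_series k"
    by (simp add: n cc_def)
  also have "\<dots> = (\<Sum>r=1..k. scal (of_nat r * ((1 - tt ^ r) / of_nat r)) *
      (var r * fps_nth c_series (k - r)))"
    unfolding c_series_def by (rule exp_series_recurrence(1))
  also have "\<dots> = (\<Sum>r=1..k. scal (1 - tt ^ r) * (var r * cc (n - int r)))"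
    by (rule sum.cong) (auto simp: n cc_def nat_diff_distrib)
  also have "\<dots> = (\<Sum>r=1..K. scal (1 - tt ^ r) * (var r * cc (n - int r)))"
    using assms n by (intro sum.mono_neutral_left) auto
  finally show ?thesis .
qed simp

lemma ct_op_recurrence:
  assumes "n \<le> int K"
  shows "of_int n * ct_op n f =
    (\<Sum>r=1..K. scal (of_nat r * (inverse qq ^ r - 1)) * dp r (ct_op (n - int r) f))"
proof (cases "n < 0")
  case False
  define k where "k = nat n"
  have n: "n = int k" using False by (simp add: k_def)
  let ?b = "\<lambda>r. inverse qq ^ r - 1"
  have "of_int n * ct_op n f = at_dp (scal (of_nat k) * fps_nth ct_series k) f"
    by (simp only: n ct_op_def at_dp_scal_mult) simp
  also have "scal (of_nat k) * fps_nth ct_series k =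
     (\<Sum>r=1..k. scal (of_nat r * ?b r) * (var r * fps_nth ct_series (k - r)))"
    unfolding ct_series_def scal_of_nat by (rule exp_series_recurrence(1))
  also have "at_dp \<dots> f = (\<Sum>r=1..k. scal (of_nat r * ?b r) * dp r (ct_op (n - int r) f))"
    unfolding at_dp_sum
    by (rule sum.cong) (auto simp: n at_dp_scal_mult at_dp_var_mult ct_op_def nat_diff_distrib)
  also have "\<dots> = (\<Sum>r=1..K. scal (of_nat r * ?b r) * dp r (ct_op (n - int r) f))"
    using assms n by (intro sum.mono_neutral_left) auto
  finally show ?thesis .
qed simp

text \<open>The substitution \<open>p_r \<mapsto> p_r + (a^r - 1) z^{-r}\<close> in terms of coefficients. In the recurrence
  for \<open>c~_k\<close> only the term with \<open>\<partial>/\<partial>p_r\<close> differentiates the factor \<open>p_r\<close>; its weight \<open>r\<close> supplies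
  what is missing between \<open>k\<close> and \<open>k - r\<close>.\<close>

lemma ct_op_var_mult_nat:
  assumes "r \<ge> 1"
  shows "ct_op (int k) (var r * f) = var r * ct_op (int k) f +
     scal (inverse qq ^ r - 1) * ct_op (int k - int r) f"
proof (induction k rule: less_induct)
  case (less k)
  show ?case
  proof (cases "k = 0")
    case False
    let ?b = "\<lambda>r. inverse qq ^ r - 1"
    let ?s = "\<lambda>m. scal (of_nat m * ?b m)"
    have IH: "ct_op (int k - int m) (var r * f) = var r * ct_op (int k - int m) f +
        scal (?b r) * ct_op (int k - int r - int m) f" if "m \<in> {1..k}" for m
    proof -
      have lt: "k - m < k" and E1: "int (k - m) = int k - int m"
        and E2: "int k - int m - int r = int k - int r - int m"
        using that by auto
      show ?thesis using less.IH[OF lt] unfolding E1 E2 .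
    qed
    have "of_nat k * ct_op (int k) (var r * f) =
        (\<Sum>m=1..k. ?s m * dp m (ct_op (int k - int m) (var r * f)))"
      using ct_op_recurrence[of "int k" k] by simp
    also have "\<dots> = (\<Sum>m=1..k. var r * (?s m * dp m (ct_op (int k - int m) f)) +
       (if m = r then ?s m * ct_op (int k - int m) f else 0) +
       scal (?b r) * (?s m * dp m (ct_op (int k - int r - int m) f)))"
      by (rule sum.cong[OF refl])
        (use assms in \<open>simp add: IH dp_add dp_var_mult dp_scal_mult distrib_left mult.left_commute\<close>)
    also have "\<dots> = var r * (of_nat k * ct_op (int k) f) +
       (if r \<le> k then ?s r * ct_op (int k - int r) f else 0) +
       scal (?b r) * (of_int (int k - int r) * ct_op (int k - int r) f)"
      using assms ct_op_recurrence[of "int k" k f] ct_op_recurrence[of "int k - int r" k f]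
      by (simp add: sum.distrib flip: sum_distrib_left)
    also have "\<dots> = of_nat k * (var r * ct_op (int k) f + scal (?b r) * ct_op (int k - int r) f)"
      unfolding scal_mult[of "of_nat r"] scal_of_nat
      by (cases "r \<le> k") (simp_all add: algebra_simps)
    finally show ?thesis using False unfolding mult_cancel_left of_nat_eq_0_iff by blast
  qed (use assms in simp)
qed

lemma ct_op_var_mult:
  assumes "r \<ge> 1"
  shows "ct_op k (var r * f) = var r * ct_op k f + scal (inverse qq ^ r - 1) * ct_op (k - int r) f"
proof (cases "k < 0")
  case False
  then show ?thesis using ct_op_var_mult_nat[OF assms, of "nat k"] by simp
qed simp

section \<open>The exchange relation\<close>

text \<open>The difference of \<open>1/q\<close> and \<open>t\<close> is the denominator of the \<open>(1/q, t)\<close>-numbers. In the iterated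
  fraction field the comparisons with 1 reduce to comparing coefficients of polynomials in the
  square root of \<open>t\<close>.\<close>

lemma tt_neq_1: "tt \<noteq> 1" and inverse_qq_neq_tt: "inverse qq \<noteq> tt"
  and qq_neq_0: "qq \<noteq> 0" and tt_neq_0: "tt \<noteq> 0"
proof -
  have eq_1: "Fract x 1 = 1 \<longleftrightarrow> x = 1" and eq_0: "Fract x 1 = 0 \<longleftrightarrow> x = 0" for x :: "'a::idom"
    by (simp_all add: One_fract_def Zero_fract_def eq_fract)
  have const_1: "[:x:] = 1 \<longleftrightarrow> x = 1" and "[:0, 0, y:] \<noteq> 1" for x y :: "'a::idom"
    by (simp_all add: one_pCons)
  note simps = tt_def th_def qq_def qh_def power2_eq_square eq_1 eq_0 this
  show "tt \<noteq> 1" "tt \<noteq> 0" and q0: "qq \<noteq> 0" by (simp_all add: simps)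
  have "tt * qq \<noteq> 1" by (simp add: simps)
  then show "inverse qq \<noteq> tt" using q0 by (metis left_inverse)
qed

text \<open>The coefficients of \<open>(1 - y)(1 - (t/q) y) / ((1 - y/q)(1 - t y))\<close>; the index type \<open>bool\<close>
  labels the two factors of the numerator and of the denominator.\<close>

definition exchange_coeff :: "int \<Rightarrow> coeff_field" where
  "exchange_coeff n = (if n < 0 then 0 else
     fps_nth (ratio_fps UNIV (\<lambda>i. if i then 1 else inverse qq * tt)
       (\<lambda>i. if i then inverse qq else tt)) (nat n))"

lemma exchange_coeff_neg [simp]: "n < 0 \<Longrightarrow> exchange_coeff n = 0"
  by (simp add: exchange_coeff_def)

lemma exchange_coeff_0 [simp]: "exchange_coeff 0 = 1"
  by (simp add: exchange_coeff_def ratio_fps_nth_0)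

lemma exchange_coeff_recurrence:
  assumes "n \<le> int K"
  shows "of_int n * exchange_coeff n =
    (\<Sum>r=1..K. (1 - tt ^ r) * (inverse qq ^ r - 1) * exchange_coeff (n - int r))"
proof (cases "n < 0")
  case False
  define k where "k = nat n"
  have n: "n = int k" using False by (simp add: k_def)
  let ?b = "\<lambda>i. if i then 1 else inverse qq * tt" and ?c = "\<lambda>i. if i then inverse qq else tt"
  let ?G = "ratio_fps UNIV ?b ?c"
  have "of_int n * exchange_coeff n = of_nat k * fps_nth ?G k"
    by (simp add: n exchange_coeff_def)
  also have "\<dots> = (\<Sum>r=1..k. (\<Sum>i\<in>UNIV. ?c i ^ r - ?b i ^ r) * fps_nth ?G (k - r))"
    by (rule ratio_fps_recurrence) simp
  also have "\<dots> = (\<Sum>r=1..k. (1 - tt ^ r) * (inverse qq ^ r - 1) * exchange_coeff (n - int r))"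
  proof (rule sum.cong[OF refl])
    fix r assume r: "r \<in> {1..k}"
    have "(\<Sum>i\<in>UNIV. ?c i ^ r - ?b i ^ r) = (1 - tt ^ r) * (inverse qq ^ r - 1)"
      by (simp add: UNIV_bool power_mult_distrib ring_distribs mult.commute
          del: power_inverse)
    moreover have "exchange_coeff (n - int r) = fps_nth ?G (k - r)"
      using r by (simp add: n exchange_coeff_def nat_diff_distrib)
    ultimately show "(\<Sum>i\<in>UNIV. ?c i ^ r - ?b i ^ r) * fps_nth ?G (k - r) =
        (1 - tt ^ r) * (inverse qq ^ r - 1) * exchange_coeff (n - int r)" by (simp only:)
  qed
  also have "\<dots> = (\<Sum>r=1..K. (1 - tt ^ r) * (inverse qq ^ r - 1) * exchange_coeff (n - int r))"
    using assms n by (intro sum.mono_neutral_left) auto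
  finally show ?thesis .
qed simp

text \<open>The product of the \<open>b_i/c_i\<close> is 1 and the two residues are opposite, so the partial
  fractions combine to a difference of powers over \<open>1/q - t\<close>.\<close>

lemma exchange_coeff_eq_qnum:
  assumes "n \<ge> 1"
  shows "exchange_coeff n = (1 - tt) * (inverse qq - 1) * qnum n (inverse qq) tt"
proof -
  define k where "k = nat n"
  have n: "n = int k" and k: "k \<noteq> 0" using assms by (simp_all add: k_def)
  let ?b = "\<lambda>i. if i then 1 else inverse qq * tt" and ?c = "\<lambda>i. if i then inverse qq else tt"
  let ?R = "residue_coeff UNIV ?b ?c"
  define a where "a = inverse qq"
  have nz: "a \<noteq> 0" "tt \<noteq> 0" "a - tt \<noteq> 0"
    using inverse_qq_neq_tt qq_neq_0 tt_neq_0 by (auto simp: a_def)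
  have R: "?R True = (1 - tt) * (a - 1) / (a - tt)" "?R False = - ((1 - tt) * (a - 1) / (a - tt))"
  proof -
    have [simp]: "UNIV - {True} = {False}" "UNIV - {False} = {True}" by auto
    have "?R True = (a - 1) / a * ((a - a * tt) / (a - tt))"
      by (simp add: residue_coeff_def a_def)
    also have "\<dots> = (1 - tt) * (a - 1) / (a - tt)"
      using nz by (simp add: divide_simps) (simp add: algebra_simps)
    finally show "?R True = (1 - tt) * (a - 1) / (a - tt)" .
    have "?R False = (tt - a * tt) / tt * ((tt - 1) / - (a - tt))"
      by (simp add: residue_coeff_def a_def)
    also have "(tt - a * tt) / tt = 1 - a"
      using nz by (simp add: diff_divide_distrib)
    also have "(1 - a) * ((tt - 1) / - (a - tt)) = - ((1 - a) * (tt - 1) / (a - tt))"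
      by (simp only: divide_minus_right mult_minus_right times_divide_eq_right)
    also have "(1 - a) * (tt - 1) = (1 - tt) * (a - 1)" by (simp add: algebra_simps)
    finally show "?R False = - ((1 - tt) * (a - 1) / (a - tt))" .
  qed
  have "exchange_coeff n = fps_nth (ratio_fps UNIV ?b ?c) k"
    by (simp add: n exchange_coeff_def)
  also have "\<dots> = (\<Sum>i\<in>UNIV. ?R i * ?c i ^ k)"
    using k inverse_qq_neq_tt qq_neq_0 tt_neq_0
    by (subst ratio_fps_partial_fractions) (auto simp: inj_on_def fps_sum_nth)
  also have "\<dots> = ?R True * a ^ k + ?R False * tt ^ k"
    by (simp add: UNIV_bool a_def add.commute)
  also have "\<dots> = (1 - tt) * (a - 1) * ((a ^ k - tt ^ k) / (a - tt))"
  proof -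
    have "x / d * y + - (x / d) * z = x * ((y - z) / d)" for x y z d :: coeff_field
      by (simp add: right_diff_distrib diff_divide_distrib)
    then show ?thesis unfolding R .
  qed
  finally show ?thesis by (simp add: qnum_def n a_def power_int_def)
qed

text \<open>The relation \<open>c~(z) c(w) = g(w/z) c(w) c~(z)\<close>, where \<open>g\<close> is the series of the exchange
  coefficients. In the induction on \<open>l\<close> the recurrence of \<open>c_l\<close> splits off a variable \<open>p_r\<close>. Commuting
  \<open>c~_k\<close> with it produces two sums: the first reassembles by the recurrence of \<open>c\<close> with factor
  \<open>l - m\<close>, the second by the recurrence of \<open>g\<close> with factor \<open>m\<close>.\<close>

lemma ct_op_cc_mult:
  "ct_op k (cc (int l) * f) =
    (\<Sum>m=0..l. scal (exchange_coeff (int m)) * (cc (int l - int m) * ct_op (k - int m) f))"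
proof (induction l arbitrary: k rule: less_induct)
  case (less l)
  let ?g = "\<lambda>m. exchange_coeff (int m)"
  show ?case
  proof (cases "l = 0")
    case False
    let ?T = "\<lambda>m. cc (int l - int m) * ct_op (k - int m) f"
    have IH: "ct_op k' (cc (int l - int r) * f) =
       (\<Sum>m=0..l. scal (?g m) * (cc (int l - int m - int r) * ct_op (k' - int m) f))"
      if r: "r \<in> {1..l}" for r k'
    proof -
      have lt: "l - r < l" and E1: "int (l - r) = int l - int r"
        using r by auto
      have E2: "int l - int r - int m = int l - int m - int r" for m by simp
      have "ct_op k' (cc (int l - int r) * f) =
         (\<Sum>m=0..l - r. scal (?g m) * (cc (int l - int m - int r) * ct_op (k' - int m) f))"
        using less.IH[OF lt] unfolding E1 E2 .
      also have "\<dots> = (\<Sum>m=0..l. scal (?g m) * (cc (int l - int m - int r) * ct_op (k' - int m) f))"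
        using r by (intro sum.mono_neutral_left) auto
      finally show ?thesis .
    qed
    (* Re-indexing by m + r: the terms with m < r carry a coefficient with negative index, and those
       with m > l carry a factor c with negative index. *)
    have shift: "(\<Sum>m=0..l. scal (?g m) * (cc (int l - int m - int r) * ct_op (k - int r - int m) f)) =
        (\<Sum>m=0..l. scal (exchange_coeff (int m - int r)) * ?T m)" for r
    proof -
      have "(\<Sum>m=0..l. scal (?g m) * (cc (int l - int m - int r) * ct_op (k - int r - int m) f)) =
        (\<Sum>m=0..l. scal (exchange_coeff (int (m + r) - int r)) * ?T (m + r))"
        by (rule sum.cong) (auto simp: algebra_simps)
      also have "\<dots> = (\<Sum>m=0+r..l+r. scal (exchange_coeff (int m - int r)) * ?T m)"
        by (rule sum.shift_bounds_cl_nat_ivl[symmetric])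
      also have "\<dots> = (\<Sum>m=0..l+r. scal (exchange_coeff (int m - int r)) * ?T m)"
        by (rule sum.mono_neutral_left) auto
      also have "\<dots> = (\<Sum>m=0..l. scal (exchange_coeff (int m - int r)) * ?T m)"
        by (rule sum.mono_neutral_right) auto
      finally show ?thesis .
    qed
    have "of_nat l * ct_op k (cc (int l) * f) = ct_op k (of_int (int l) * cc (int l) * f)"
      using ct_op_scal_mult[of k "of_nat l"] by (simp add: mult.assoc)
    also have "\<dots> = ct_op k (\<Sum>r=1..l. scal (1 - tt ^ r) * (var r * (cc (int l - int r) * f)))"
      by (subst cc_recurrence[of "int l" l]) (simp_all add: sum_distrib_right mult.assoc)
    also have "\<dots> = (\<Sum>r=1..l. scal (1 - tt ^ r) *
        (var r * ct_op k (cc (int l - int r) * f) +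
         scal (inverse qq ^ r - 1) * ct_op (k - int r) (cc (int l - int r) * f)))"
      unfolding ct_op_sum ct_op_scal_mult by (rule sum.cong[OF refl]) (simp only: ct_op_var_mult atLeastAtMost_iff)
    also have "\<dots> = (\<Sum>r=1..l. scal (1 - tt ^ r) *
        (var r * (\<Sum>m=0..l. scal (?g m) * (cc (int l - int m - int r) * ct_op (k - int m) f)) +
         scal (inverse qq ^ r - 1) * (\<Sum>m=0..l. scal (exchange_coeff (int m - int r)) * ?T m)))"
      by (rule sum.cong[OF refl]) (simp only: IH shift)
    also have "\<dots> = (\<Sum>r=1..l. \<Sum>m=0..l.
         scal (1 - tt ^ r) * (var r * cc (int l - int m - int r)) * (scal (?g m) * ct_op (k - int m) f) +
         scal ((1 - tt ^ r) * (inverse qq ^ r - 1) * exchange_coeff (int m - int r)) * ?T m)"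
      by (simp only: distrib_left sum_distrib_left sum.distrib scal_mult mult_ac)
    also have "\<dots> = (\<Sum>m=0..l. 
         (\<Sum>r=1..l. scal (1 - tt ^ r) * (var r * cc (int l - int m - int r))) * (scal (?g m) * ct_op (k - int m) f) +
         scal (\<Sum>r=1..l. (1 - tt ^ r) * (inverse qq ^ r - 1) * exchange_coeff (int m - int r)) * ?T m)"
      by (subst sum.swap) (simp only: sum.distrib sum_distrib_right scal_sum)
    also have "\<dots> = (\<Sum>m=0..l. (of_int (int l - int m) * cc (int l - int m)) * (scal (?g m) * ct_op (k - int m) f) +
         scal (of_int (int m) * ?g m) * ?T m)"
    proof (rule sum.cong[OF refl])
      fix m assume m: "m \<in> {0..l}"
      have "of_int (int l - int m) * cc (int l - int m) =
          (\<Sum>r=1..l. scal (1 - tt ^ r) * (var r * cc (int l - int m - int r)))"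
        by (rule cc_recurrence) simp
      moreover have "of_int (int m) * ?g m =
          (\<Sum>r=1..l. (1 - tt ^ r) * (inverse qq ^ r - 1) * exchange_coeff (int m - int r))"
        by (rule exchange_coeff_recurrence) (use m in simp)
      ultimately show "(\<Sum>r=1..l. scal (1 - tt ^ r) * (var r * cc (int l - int m - int r))) *
           (scal (?g m) * ct_op (k - int m) f) +
         scal (\<Sum>r=1..l. (1 - tt ^ r) * (inverse qq ^ r - 1) * exchange_coeff (int m - int r)) * ?T m =
         (of_int (int l - int m) * cc (int l - int m)) * (scal (?g m) * ct_op (k - int m) f) +
         scal (of_int (int m) * ?g m) * ?T m"
        by (simp only:)
    qed
    also have "\<dots> = of_nat l * (\<Sum>m=0..l. scal (?g m) * ?T m)"
      unfolding sum_distrib_left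
      by (rule sum.cong[OF refl]) (simp add: scal_mult algebra_simps)
    finally show ?thesis using False unfolding mult_cancel_left of_nat_eq_0_iff by blast
  qed simp
qed

section \<open>Power sums in finitely many variables\<close>

definition monom_subst :: "(nat \<Rightarrow> kpoly) \<Rightarrow> (nat \<Rightarrow>\<^sub>0 nat) \<Rightarrow> kpoly" where
  "monom_subst \<phi> \<alpha> = (\<Prod>i\<in>Poly_Mapping.keys \<alpha>. \<phi> (Suc i) ^ Poly_Mapping.lookup \<alpha> i)"

lemma monom_subst_Suc:
  "monom_subst \<phi> (Poly_Mapping.single i 1 + \<alpha>) = \<phi> (Suc i) * monom_subst \<phi> \<alpha>"
proof -
  let ?\<beta> = "Poly_Mapping.single i 1 + \<alpha>" and ?K = "insert i (Poly_Mapping.keys \<alpha>)"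
  have K: "Poly_Mapping.keys ?\<beta> = ?K"
    by (auto simp: in_keys_iff lookup_add lookup_single when_def split: if_splits)
  have "monom_subst \<phi> \<alpha> = (\<Prod>j\<in>?K. \<phi> (Suc j) ^ Poly_Mapping.lookup \<alpha> j)"
    unfolding monom_subst_def by (rule prod.mono_neutral_left) (auto simp: in_keys_iff)
  moreover have "monom_subst \<phi> ?\<beta> =
      (\<Prod>j\<in>?K. (if j = i then \<phi> (Suc j) else 1) * \<phi> (Suc j) ^ Poly_Mapping.lookup \<alpha> j)"
    unfolding monom_subst_def K
    by (rule prod.cong) (auto simp: lookup_add lookup_single when_def One_nat_def)
  moreover have "\<dots> = \<phi> (Suc i) * (\<Prod>j\<in>?K. \<phi> (Suc j) ^ Poly_Mapping.lookup \<alpha> j)"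
    by (simp only: prod.distrib) simp
  ultimately show ?thesis by simp
qed

lemma poly_subst_add: "poly_subst \<phi> (f + g) = poly_subst \<phi> f + poly_subst \<phi> g"
  unfolding poly_subst_def
  by (rule setsum_keys_plus_distrib) (simp_all add: distrib_right scal_add)

lemma poly_subst_single: "poly_subst \<phi> (Poly_Mapping.single \<alpha> a) = scal a * monom_subst \<phi> \<alpha>"
  by (simp add: poly_subst_def monom_subst_def)

lemma poly_subst_scal [simp]: "poly_subst \<phi> (scal a) = scal a"
  unfolding scal_def[of a] poly_subst_single by (simp add: monom_subst_def scal_def)

lemma poly_subst_scal_mult: "poly_subst \<phi> (scal a * f) = scal a * poly_subst \<phi> f"
  by (induction f rule: kpoly_induct_monomials)
    (simp_all add: poly_subst_add poly_subst_single scal_mult_single distrib_left scal_mult mult.assoc)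

lemma poly_subst_var_mult:
  assumes "r \<ge> 1"
  shows "poly_subst \<phi> (var r * f) = \<phi> r * poly_subst \<phi> f"
proof -
  obtain i where r: "r = Suc i" using assms by (cases r) auto
  show ?thesis unfolding r
    by (induction f rule: kpoly_induct_monomials)
      (simp_all add: poly_subst_add poly_subst_single var_mult_single monom_subst_Suc
         distrib_left mult.left_commute)
qed

lemma poly_subst_mult: "poly_subst \<phi> (f * g) = poly_subst \<phi> f * poly_subst \<phi> g"
  by (induction f rule: kpoly_induct)
    (simp_all add: poly_subst_scal_mult poly_subst_add poly_subst_var_mult distrib_right mult.assoc)

lemma poly_subst_1 [simp]: "poly_subst \<phi> 1 = 1"
  using poly_subst_scal[of \<phi> 1] by simp

lemma poly_subst_0 [simp]: "poly_subst \<phi> 0 = 0"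
  using poly_subst_scal[of \<phi> 0] by simp

lemma poly_subst_var [simp]: "r \<ge> 1 \<Longrightarrow> poly_subst \<phi> (var r) = \<phi> r"
  using poly_subst_var_mult[of r \<phi> 1] by simp

lemma poly_subst_power: "poly_subst \<phi> (f ^ n) = poly_subst \<phi> f ^ n"
  by (induction n) (simp_all add: poly_subst_mult)

lemma poly_subst_sum: "poly_subst \<phi> (sum f A) = (\<Sum>i\<in>A. poly_subst \<phi> (f i))"
  by (induction A rule: infinite_finite_induct) (simp_all add: poly_subst_add)

lemma shift_inv_power_sum:
  assumes "i \<in> {1..N}"
  shows "shift_inv i (\<Sum>j=1..N. var j ^ r) =
    (\<Sum>j=1..N. var j ^ r) + scal (inverse qq ^ r - 1) * var i ^ r"
proof -
  have scal_power: "scal a ^ r = scal (a ^ r)" for a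
    by (induction r) (simp_all add: scal_mult)
  have "shift_inv i (\<Sum>j=1..N. var j ^ r) =
      (\<Sum>j=1..N. var j ^ r + (if j = i then scal (inverse qq ^ r - 1) * var j ^ r else 0))"
    unfolding shift_inv_def poly_subst_sum poly_subst_power
    by (rule sum.cong) (auto simp: power_mult_distrib scal_power scal_diff left_diff_distrib)
  also have "\<dots> = (\<Sum>j=1..N. var j ^ r) + scal (inverse qq ^ r - 1) * var i ^ r"
    using assms by (simp add: sum.distrib)
  finally show ?thesis .
qed

lemma ct_op_scal:
  "ct_op (int k) (scal a) = (if k = 0 then scal a else 0)"
proof (cases "k = 0")
  case False
  then have "ct_op (int k) (scal a) = 0"
    by (intro ct_op_eq_0) (auto simp: scal_def split: if_splits)
  then show ?thesis using False by simp
qed simp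

text \<open>Both sides are compatible with multiplication by \<open>p_r\<close>: on the left \<open>c~(z)\<close> adds
  \<open>(a^r - 1) z^{-r}\<close> with \<open>z^{-1} = x_i\<close>, on the right the shift adds \<open>(a^r - 1) x_i^r\<close> to the power
  sum.\<close>

lemma shift_inv_power_sum_subst:
  assumes i: "i \<in> {1..N}"
  shows "\<forall>\<^sub>F M in sequentially.
    (\<Sum>k=0..M. power_sum_subst N (ct_op (int k) f) * var i ^ k) = shift_inv i (power_sum_subst N f)"
proof (induction f rule: kpoly_induct)
  case (scal a)
  have "(\<Sum>k=0..M. power_sum_subst N (ct_op (int k) (scal a)) * var i ^ k) =
      (\<Sum>k\<in>{0}. power_sum_subst N (ct_op (int k) (scal a)) * var i ^ k)" for M
    by (rule sum.mono_neutral_right) (auto simp: ct_op_scal power_sum_subst_def)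
  then show ?case by (simp add: power_sum_subst_def shift_inv_def)
next
  case (add f g)
  then show ?case
    by eventually_elim (simp add: ct_op_add power_sum_subst_def shift_inv_def poly_subst_add
       distrib_right sum.distrib)
next
  case (var r f)
  let ?\<phi> = "power_sum_subst N"
  from var obtain M0 where M0: "\<And>M. M \<ge> M0 \<Longrightarrow>
    (\<Sum>k=0..M. ?\<phi> (ct_op (int k) f) * var i ^ k) = shift_inv i (?\<phi> f)"
    unfolding eventually_sequentially by blast
  have "(\<Sum>k=0..M. ?\<phi> (ct_op (int k) (var r * f)) * var i ^ k) = shift_inv i (?\<phi> (var r * f))"
    if M: "M \<ge> M0 + r" for M
  proof -
    let ?p = "\<Sum>j=1..N. var j ^ r" and ?b = "scal (inverse qq ^ r - 1)"
    have "(\<Sum>k=0..M. ?\<phi> (ct_op (int k - int r) f) * var i ^ k) =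
        (\<Sum>k=0+r..(M-r)+r. ?\<phi> (ct_op (int k - int r) f) * var i ^ k)"
      using M by (intro sum.mono_neutral_right) (auto simp: power_sum_subst_def)
    also have "\<dots> = (\<Sum>k=0..M-r. ?\<phi> (ct_op (int k) f) * (var i ^ r * var i ^ k))"
      unfolding sum.shift_bounds_cl_nat_ivl by (simp add: power_add mult.commute)
    also have "\<dots> = var i ^ r * (\<Sum>k=0..M-r. ?\<phi> (ct_op (int k) f) * var i ^ k)"
      by (simp add: sum_distrib_left mult.left_commute)
    also have "\<dots> = var i ^ r * shift_inv i (?\<phi> f)" using M M0[of "M - r"] by simp
    finally have S: "(\<Sum>k=0..M. ?\<phi> (ct_op (int k - int r) f) * var i ^ k) =
        var i ^ r * shift_inv i (?\<phi> f)" .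
    have "(\<Sum>k=0..M. ?\<phi> (ct_op (int k) (var r * f)) * var i ^ k) =
       (\<Sum>k=0..M. ?p * (?\<phi> (ct_op (int k) f) * var i ^ k) +
          ?b * (?\<phi> (ct_op (int k - int r) f) * var i ^ k))"
      using var(1) by (simp add: ct_op_var_mult power_sum_subst_def poly_subst_add
         poly_subst_var_mult poly_subst_scal_mult distrib_right mult.assoc)
    also have "\<dots> = ?p * shift_inv i (?\<phi> f) + ?b * (var i ^ r * shift_inv i (?\<phi> f))"
      using M M0[of M] unfolding sum.distrib sum_distrib_left[symmetric] S by simp
    also have "\<dots> = shift_inv i ?p * shift_inv i (?\<phi> f)"
      unfolding shift_inv_power_sum[OF i] by (simp only: distrib_right mult.assoc)
    also have "\<dots> = shift_inv i (?\<phi> (var r * f))"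
      using var(1) by (simp add: power_sum_subst_def shift_inv_def poly_subst_var_mult poly_subst_mult)
    finally show ?thesis .
  qed
  then show ?case unfolding eventually_sequentially by blast
qed

lemma to_frac_add: "to_frac (f + g) = to_frac f + to_frac g"
  and to_frac_diff: "to_frac (f - g) = to_frac f - to_frac g"
  and to_frac_mult: "to_frac (f * g) = to_frac f * to_frac g"
  and to_frac_0 [simp]: "to_frac 0 = 0"
  and to_frac_1 [simp]: "to_frac 1 = 1"
  and to_frac_eq_iff [simp]: "to_frac f = to_frac g \<longleftrightarrow> f = g"
  by (simp_all add: to_frac_def Zero_fract_def One_fract_def eq_fract)

lemma to_frac_eq_0_iff [simp]: "to_frac f = 0 \<longleftrightarrow> f = 0"
  using to_frac_eq_iff[of f 0] by (simp del: to_frac_eq_iff)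

lemma to_frac_sum: "to_frac (sum f A) = (\<Sum>i\<in>A. to_frac (f i))"
  by (induction A rule: infinite_finite_induct) (simp_all add: to_frac_add)

lemma to_frac_power: "to_frac (f ^ n) = to_frac f ^ n"
  by (induction n) (simp_all add: to_frac_mult)

lemma to_frac_of_nat: "to_frac (of_nat n) = of_nat n"
  by (induction n) (simp_all add: to_frac_add)

lemma scal_eq_iff [simp]: "scal a = scal b \<longleftrightarrow> a = b"
  by (metis scal_def lookup_single_eq)

lemma var_inj: "i \<ge> 1 \<Longrightarrow> j \<ge> 1 \<Longrightarrow> var i = var j \<longleftrightarrow> i = j"
proof
  assume ij: "i \<ge> 1" "j \<ge> 1" "var i = var j"
  then have "Poly_Mapping.keys (var i) = Poly_Mapping.keys (var j)" by simp
  then have "Poly_Mapping.single (i - 1) (1::nat) = Poly_Mapping.single (j - 1) 1"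
    by (simp add: keys_var)
  then have "Poly_Mapping.keys (Poly_Mapping.single (i - 1) (1::nat)) = 
    Poly_Mapping.keys (Poly_Mapping.single (j - 1) (1::nat))" by simp
  then show "i = j" using ij by simp
qed simp

lemma var_neq_0 [simp]: "var i \<noteq> 0"
  using keys_var[of i] by auto

text \<open>In \<open>N\<close> variables \<open>c(z)\<close> is \<open>\<Prod>_i (1 - t x_i z)/(1 - x_i z)\<close>, because both series satisfy the
  same recurrence.\<close>

lemma power_sum_subst_cc:
  "to_frac (power_sum_subst N (cc (int k))) =
    fps_nth (ratio_fps {1..N} (\<lambda>i. to_frac (scal tt) * to_frac (var i)) (\<lambda>i. to_frac (var i))) k"
proof (induction k rule: less_induct)
  case (less k)
  let ?\<tau> = "to_frac (scal tt)" and ?x = "\<lambda>i. to_frac (var i)"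
  let ?P = "ratio_fps {1..N} (\<lambda>i. ?\<tau> * ?x i) ?x"
  let ?h = "\<lambda>k. to_frac (power_sum_subst N (cc k))"
  show ?case
  proof (cases "k = 0")
    case True
    then show ?thesis by (simp add: ratio_fps_nth_0 power_sum_subst_def)
  next
    case False
    have scal_power: "scal (tt ^ r) = scal tt ^ r" for r
      by (induction r) (simp_all add: scal_mult)
    have "of_nat k * ?h (int k) = to_frac (power_sum_subst N (of_int (int k) * cc (int k)))"
      unfolding power_sum_subst_def of_int_of_nat_eq scal_of_nat[symmetric] poly_subst_scal_mult
      by (simp add: to_frac_mult to_frac_of_nat)
    also have "\<dots> = (\<Sum>r=1..k. to_frac (scal (1 - tt ^ r)) * ((\<Sum>i=1..N. ?x i ^ r) * ?h (int k - int r)))"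
      unfolding cc_recurrence[of "int k" k, OF order_refl]
      by (simp add: power_sum_subst_def poly_subst_sum poly_subst_scal_mult poly_subst_var_mult
           to_frac_sum to_frac_mult to_frac_power)
    also have "\<dots> = (\<Sum>r=1..k. (\<Sum>i\<in>{1..N}. ?x i ^ r - (?\<tau> * ?x i) ^ r) * fps_nth ?P (k - r))"
    proof (rule sum.cong[OF refl])
      fix r assume r: "r \<in> {1..k}"
      then have h: "?h (int k - int r) = fps_nth ?P (k - r)"
        using less.IH[of "k - r"] by (simp add: of_nat_diff)
      have "to_frac (scal (1 - tt ^ r)) * (\<Sum>i=1..N. ?x i ^ r) =
         (\<Sum>i\<in>{1..N}. ?x i ^ r - (?\<tau> * ?x i) ^ r)"
        by (simp add: sum_distrib_left scal_diff scal_power to_frac_diff to_frac_power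
          left_diff_distrib power_mult_distrib)
      then show "to_frac (scal (1 - tt ^ r)) * ((\<Sum>i=1..N. ?x i ^ r) * ?h (int k - int r)) =
          (\<Sum>i\<in>{1..N}. ?x i ^ r - (?\<tau> * ?x i) ^ r) * fps_nth ?P (k - r)"
        unfolding h by (simp only: mult.assoc[symmetric])
    qed
    also have "\<dots> = of_nat k * fps_nth ?P k"
      by (rule ratio_fps_recurrence[symmetric]) simp
    finally have "of_nat k * ?h (int k) = of_nat k * fps_nth ?P k" .
    moreover have "of_nat k \<noteq> (0 :: kpoly fract)"
      using False unfolding to_frac_of_nat[symmetric] by simp
    ultimately show ?thesis by simp
  qed
qed

text \<open>The constant \<open>t^N\<close> of the partial fraction expansion contributes only to \<open>k = 0\<close>, and each
  fraction \<open>1/(1 - x_i z)\<close> contributes one shifted function. Adding the term \<open>k = 0\<close>, which is \<open>f\<close>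
  itself, accounts for the \<open>1\<close> in \<open>(1 - t^N)/(1 - t)\<close>.\<close>

lemma power_sum_subst_eq_RM_inverted:
  assumes N: "N \<ge> 1"
  shows "\<forall>\<^sub>F M in sequentially. to_frac (power_sum_subst N
      (scal (1 / (1 - tt)) * (\<Sum>k=1..M. cc (int k) * ct_op (int k) f))) =
    RM_inverted N (power_sum_subst N f)"
proof -
  let ?\<phi> = "power_sum_subst N"
  have "\<forall>\<^sub>F M in sequentially. \<forall>i\<in>{1..N}.
    (\<Sum>k=0..M. ?\<phi> (ct_op (int k) f) * var i ^ k) = shift_inv i (?\<phi> f)"
    by (intro eventually_ball_finite) (auto intro: shift_inv_power_sum_subst)
  then show ?thesis
  proof eventually_elim
    case (elim M)
    define x where "x i = to_frac (var i)" for i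
    define \<tau> where "\<tau> = to_frac (scal tt)"
    define F where "F = to_frac (?\<phi> f)"
    define S where "S i = to_frac (shift_inv i (?\<phi> f))" for i
    define R where "R = residue_coeff {1..N} (\<lambda>i. \<tau> * x i) x"
    have \<tau>: "\<tau> \<noteq> 0" "1 - \<tau> \<noteq> 0"
      using tt_neq_0 tt_neq_1 scal_eq_iff[of tt 0] scal_eq_iff[of 1 tt]
      by (auto simp: \<tau>_def simp del: scal_eq_iff to_frac_eq_iff simp flip: to_frac_1 to_frac_diff)
    have \<tau>_pow: "\<tau> ^ n = to_frac (scal (tt ^ n))" for n
      by (induction n) (simp_all add: \<tau>_def scal_mult to_frac_mult)
    have \<tau>_1: "1 - \<tau> = to_frac (scal (1 - tt))"
      by (simp add: \<tau>_def scal_diff to_frac_diff)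
    have x0: "x i \<noteq> 0" for i by (simp add: x_def)
    have inj: "inj_on x {1..N}" by (auto simp: inj_on_def x_def var_inj)
    have S: "(\<Sum>k=0..M. to_frac (?\<phi> (ct_op (int k) f)) * x i ^ k) = S i" if "i \<in> {1..N}" for i
      using elim that by (simp add: S_def x_def flip: to_frac_power to_frac_mult to_frac_sum)
    have h: "to_frac (?\<phi> (cc (int k))) = (if k = 0 then \<tau> ^ N else 0) + (\<Sum>i=1..N. R i * x i ^ k)" for k
    proof -
      have "to_frac (?\<phi> (cc (int k))) = fps_nth (ratio_fps {1..N} (\<lambda>i. \<tau> * x i) x) k"
        unfolding power_sum_subst_cc \<tau>_def x_def ..
      also have "\<dots> = (if k = 0 then \<tau> ^ N else 0) + (\<Sum>i=1..N. R i * x i ^ k)"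
        by (subst ratio_fps_partial_fractions) (use inj x0 in \<open>auto simp: fps_sum_nth R_def\<close>)
      finally show ?thesis .
    qed
    (* The power of t distributes over the N - 1 factors with j different from i. *)
    have R: "R i = (1 - \<tau>) * (\<tau> ^ (N - 1) * (\<Prod>j\<in>{1..N} - {i}. (to_frac (scal (inverse tt) * var i) - x j) / (x i - x j)))"
      if i: "i \<in> {1..N}" for i
    proof -
      have inv: "\<tau> * to_frac (scal (inverse tt) * var i) = x i"
        using tt_neq_0 by (simp add: \<tau>_def x_def scal_mult_left flip: to_frac_mult)
      have card: "card ({1..N} - {i}) = N - 1" using i by simp
      have "\<tau> ^ (N - 1) * (\<Prod>j\<in>{1..N} - {i}. (to_frac (scal (inverse tt) * var i) - x j) / (x i - x j)) =
        (\<Prod>j\<in>{1..N} - {i}. \<tau> * ((to_frac (scal (inverse tt) * var i) - x j) / (x i - x j)))"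
        by (simp only: prod.distrib prod_constant card)
      also have "\<dots> = (\<Prod>j\<in>{1..N} - {i}. (x i - \<tau> * x j) / (x i - x j))"
        by (simp add: right_diff_distrib inv)
      finally show ?thesis using x0 by (simp add: R_def residue_coeff_def diff_divide_distrib)
    qed
    define DB where "DB = scal (1 / (1 - tt)) * (\<Sum>k=1..M. cc (int k) * ct_op (int k) f)"
    have "scal (1 - tt) * DB + f = (\<Sum>k=1..M. cc (int k) * ct_op (int k) f) + f"
      using tt_neq_1 by (simp add: DB_def scal_mult_left)
    also have "\<dots> = (\<Sum>k=0..M. cc (int k) * ct_op (int k) f)"
      by (simp add: sum.atLeast_Suc_atMost[of 0] One_nat_def add.commute)
    finally have "to_frac (?\<phi> (scal (1 - tt) * DB + f)) = to_frac (?\<phi> (\<Sum>k=0..M. cc (int k) * ct_op (int k) f))"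
      by simp
    then have "(1 - \<tau>) * to_frac (?\<phi> DB) + F =
        (\<Sum>k=0..M. to_frac (?\<phi> (cc (int k))) * to_frac (?\<phi> (ct_op (int k) f)))"
      by (simp add: power_sum_subst_def poly_subst_add poly_subst_scal_mult poly_subst_sum
        poly_subst_mult to_frac_add to_frac_mult to_frac_sum \<tau>_1 F_def)
    also have "\<dots> = (\<Sum>k=0..M. if k = 0 then \<tau> ^ N * F else 0) +
        (\<Sum>k=0..M. \<Sum>i=1..N. R i * (to_frac (?\<phi> (ct_op (int k) f)) * x i ^ k))"
    proof -
      have "to_frac (?\<phi> (cc (int k))) * to_frac (?\<phi> (ct_op (int k) f)) =
         (if k = 0 then \<tau> ^ N * F else 0) +
         (\<Sum>i=1..N. R i * (to_frac (?\<phi> (ct_op (int k) f)) * x i ^ k))" for k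
        unfolding h distrib_right sum_distrib_right by (simp add: F_def mult_ac)
      then show ?thesis by (simp only: sum.distrib)
    qed
    also have "\<dots> = \<tau> ^ N * F + (\<Sum>i=1..N. R i * S i)"
      by (subst sum.swap) (simp add: S flip: sum_distrib_left)
    finally have "(1 - \<tau>) * to_frac (?\<phi> DB) = (\<Sum>i=1..N. R i * S i) - (1 - \<tau> ^ N) * F"
      by (simp add: algebra_simps)
    then have "to_frac (?\<phi> DB) = ((\<Sum>i=1..N. R i * S i) - (1 - \<tau> ^ N) * F) / (1 - \<tau>)"
      using \<tau> by (simp add: eq_divide_eq mult.commute)
    then have "to_frac (?\<phi> DB) = (\<Sum>i=1..N. R i * S i) / (1 - \<tau>) - (1 - \<tau> ^ N) / (1 - \<tau>) * F"
      by (simp only: diff_divide_distrib[of "\<Sum>i=1..N. R i * S i"] times_divide_eq_left)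
    also have "(\<Sum>i=1..N. R i * S i) / (1 - \<tau>) = \<tau> ^ (N - 1) * (\<Sum>i=1..N.
        (\<Prod>j\<in>{1..N} - {i}. (to_frac (scal (inverse tt) * var i) - x j) / (x i - x j)) * S i)"
      unfolding sum_distrib_left sum_divide_distrib
      by (rule sum.cong[OF refl]) (use \<tau> in \<open>simp add: R\<close>)
    also have "(1 - \<tau> ^ N) / (1 - \<tau>) = to_frac (scal ((1 - tt ^ N) / (1 - tt)))"
    proof -
      have "to_frac (scal ((1 - tt ^ N) / (1 - tt))) * (1 - \<tau>) =
          to_frac (scal ((1 - tt ^ N) / (1 - tt) * (1 - tt)))"
        by (simp only: \<tau>_1 scal_mult to_frac_mult)
      also have "\<dots> = 1 - \<tau> ^ N"
        using tt_neq_1 by (simp add: \<tau>_pow scal_diff to_frac_diff)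
      finally have "to_frac (scal ((1 - tt ^ N) / (1 - tt))) * (1 - \<tau>) = 1 - \<tau> ^ N" .
      then show ?thesis using \<tau> by (simp add: divide_eq_eq)
    qed
    finally show ?case
      by (simp only: RM_inverted_def \<tau>_pow x_def S_def F_def DB_def)
  qed
qed

section \<open>Operators on the exterior algebra\<close>

lemma lookup_lift_op: "L 0 = 0 \<Longrightarrow> Poly_Mapping.lookup (lift_op L x) I = L (Poly_Mapping.lookup x I)"
  by (simp add: lift_op_def map.rep_eq when_def)

lemma ext_sign_cases: "ext_sign k J = 1 \<or> ext_sign k J = -1"
  unfolding ext_sign_def by (simp add: minus_one_power_iff)

text \<open>The entries of an element are themselves finitely supported functions, so extensionality is
  invoked here exactly once, at the level of the exterior monomials.\<close>

lemma additive_by_components: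
  fixes T :: "superpoly \<Rightarrow> superpoly"
  assumes "\<And>x y I. Poly_Mapping.lookup (T (x + y)) I =
    Poly_Mapping.lookup (T x) I + Poly_Mapping.lookup (T y) I"
  shows "additive T"
  unfolding additive_def by (auto simp: poly_mapping_eq_iff fun_eq_iff assms lookup_add)

lemma pi_op_additive: "additive (pi_op k)" and dpi_op_additive: "additive (dpi_op k)"
  by (rule additive_by_components,
      simp only: lookup_pi_op lookup_dpi_op lookup_add distrib_left if_distrib, simp)+

lemma lift_op_additive:
  assumes "additive L"
  shows "additive (lift_op L)"
proof -
  interpret additive L by fact
  show ?thesis
    by (rule additive_by_components) (simp only: lookup_lift_op[of L, OF zero] add lookup_add)
qed

text \<open>The exterior signs are \<open>\<plusminus>1\<close>, so an additive operator on polynomials passes through them; this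
  is why such operators commute with all \<open>\<pi>_k\<close> and \<open>\<partial>/\<partial>\<pi>_k\<close>.\<close>

lemma lift_op_ext_sign:
  assumes "additive L"
  shows "L (ext_sign k J * f) = ext_sign k J * L f"
proof -
  interpret additive L by fact
  show ?thesis using ext_sign_cases[of k J] by (auto simp: minus)
qed

lemma lift_op_pi_op:
  assumes "additive L"
  shows "lift_op L (pi_op k x) = pi_op k (lift_op L x)"
proof -
  interpret additive L by fact
  show ?thesis
    by (rule poly_mapping_eqI) (simp add: lookup_lift_op zero lookup_pi_op lift_op_ext_sign[OF assms])
qed

lemma lift_op_dpi_op:
  assumes "additive L"
  shows "lift_op L (dpi_op k x) = dpi_op k (lift_op L x)"
proof -
  interpret additive L by fact
  show ?thesis
    by (rule poly_mapping_eqI) (simp add: lookup_lift_op zero lookup_dpi_op lift_op_ext_sign[OF assms])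
qed

lemma lift_op_lift_op:
  assumes "L 0 = 0" "L' 0 = 0"
  shows "lift_op L (lift_op L' x) = lift_op (\<lambda>f. L (L' f)) x"
  by (rule poly_mapping_eqI) (simp add: lookup_lift_op assms)

lemma lift_op_add_op:
  assumes "L 0 = 0" "L' 0 = 0"
  shows "lift_op (\<lambda>f. L f + L' f) x = lift_op L x + lift_op L' x"
  by (rule poly_mapping_eqI) (simp add: lookup_lift_op lookup_add assms)

lemma lookup_smult_R: "Poly_Mapping.lookup (smult_R a x) I = scal a * Poly_Mapping.lookup x I"
  by (simp add: smult_R_def lookup_lift_op)

lemma smult_R_additive: "additive (smult_R a)"
  by (rule additive_by_components) (simp only: lookup_smult_R lookup_add distrib_left)

lemma smult_R_lift_op: "L 0 = 0 \<Longrightarrow> smult_R a (lift_op L x) = lift_op (\<lambda>f. scal a * L f) x"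
  unfolding smult_R_def by (simp add: lift_op_lift_op)

lemma smult_R_eq_0_iff: "a \<noteq> 0 \<Longrightarrow> smult_R a x = 0 \<longleftrightarrow> x = 0"
proof
  assume a: "a \<noteq> 0" and x: "smult_R a x = 0"
  show "x = 0"
  proof (rule poly_mapping_eqI)
    fix I
    have "scal a * Poly_Mapping.lookup x I = 0" using x by (metis lookup_smult_R lookup_zero)
    moreover have "scal a \<noteq> 0" using a scal_eq_iff[of a 0] by simp
    ultimately show "Poly_Mapping.lookup x I = Poly_Mapping.lookup 0 I" by simp
  qed
qed (simp add: additive.zero[OF smult_R_additive])

lemma cc_mult_additive: "additive (\<lambda>f. cc n * f)" and ct_op_additive: "additive (ct_op n)"
  and Ctilde_additive: "additive (Ctilde k l)"
  by (simp_all add: additive_def distrib_left ct_op_add Ctilde_def sum.distrib)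

lemma op_sum_eq_sum:
  assumes "finite T" "T \<subseteq> S" "{i \<in> S. A i x \<noteq> 0} \<subseteq> T"
  shows "op_sum S A x = (\<Sum>i\<in>T. A i x)"
  unfolding op_sum_def using assms by (intro sum.mono_neutral_left) auto

lemma eventually_op_sum_from_1:
  assumes "locally_finite {1..} A"
  shows "\<forall>\<^sub>F M in sequentially. op_sum {1..} A x = (\<Sum>k=1..M. A k x)"
proof -
  have "finite {k \<in> {1..}. A k x \<noteq> 0}" using assms by (simp add: locally_finite_def)
  then obtain M0 where M0: "{k \<in> {1..}. A k x \<noteq> 0} \<subseteq> {..M0}"
    using finite_nat_iff_bounded_le by blast
  have "op_sum {1..} A x = (\<Sum>k=1..M. A k x)" if "M \<ge> M0" for M
    using M0 that by (intro op_sum_eq_sum) auto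
  then show ?thesis unfolding eventually_sequentially by blast
qed

lemma eventually_op_sum_pairs_from_1:
  assumes "locally_finite ({1..} \<times> {1..}) A"
  shows "\<forall>\<^sub>F M in sequentially.
    op_sum ({1..} \<times> {1..}) A x = (\<Sum>k=1..M. \<Sum>l=1..M. A (k, l) x)"
proof -
  let ?S = "{kl \<in> {1..} \<times> {1..}. A kl x \<noteq> 0}"
  have fin: "finite ?S" using assms by (simp add: locally_finite_def)
  obtain K where K: "fst ` ?S \<subseteq> {..K}" using fin finite_nat_iff_bounded_le by blast
  obtain L where L: "snd ` ?S \<subseteq> {..L}" using fin finite_nat_iff_bounded_le by blast
  have "op_sum ({1..} \<times> {1..}) A x = (\<Sum>k=1..M. \<Sum>l=1..M. A (k, l) x)" if M: "M \<ge> max K L" for M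
  proof -
    have "?S \<subseteq> {1..M} \<times> {1..M}"
    proof
      fix kl assume kl: "kl \<in> ?S"
      then have "fst kl \<le> K" "snd kl \<le> L" using K L by auto
      then show "kl \<in> {1..M} \<times> {1..M}" using kl M by auto
    qed
    then have "op_sum ({1..} \<times> {1..}) A x = (\<Sum>kl\<in>{1..M} \<times> {1..M}. A kl x)"
      by (intro op_sum_eq_sum) auto
    then show ?thesis by (simp add: sum.cartesian_product)
  qed
  then show ?thesis unfolding eventually_sequentially by blast
qed

lemma
  assumes inj: "inj_on h S" and sub: "h ` S \<subseteq> T"
    and zero: "\<And>j x. j \<in> T - h ` S \<Longrightarrow> B j x = 0" and eq: "\<And>i x. i \<in> S \<Longrightarrow> B (h i) x = A i x"
  shows op_sum_reindex: "op_sum T B = op_sum S A"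
    and locally_finite_reindex: "locally_finite S A \<Longrightarrow> locally_finite T B"
proof -
  have *: "{j \<in> T. B j x \<noteq> 0} = h ` {i \<in> S. A i x \<noteq> 0}" for x
    using sub zero eq by fastforce
  show "op_sum T B = op_sum S A"
  proof
    fix x
    have "inj_on h {i \<in> S. A i x \<noteq> 0}" using inj by (auto simp: inj_on_def)
    then show "op_sum T B x = op_sum S A x"
      unfolding op_sum_def * by (subst sum.reindex) (auto simp: eq intro!: sum.cong)
  qed
  show "locally_finite S A \<Longrightarrow> locally_finite T B"
    unfolding locally_finite_def * by blast
qed

section \<open>The anticommutator\<close>

lemma Ctilde_eq:
  "Ctilde k l f = (\<Sum>j<k. scal (exchange_coeff (int k - int j)) * (cc (int l - int k + int j) * ct_op (int j) f))"
proof -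
  have "Ctilde k l f = (\<Sum>n = int l - int k..int l - 1.
     scal (exchange_coeff (int l - n)) * (cc n * ct_op (int k - int l + n) f))"
    unfolding Ctilde_def sum_distrib_left
    by (rule sum.cong) (auto simp: exchange_coeff_eq_qnum scal_mult mult.assoc)
  also have "\<dots> = (\<Sum>j<k. scal (exchange_coeff (int k - int j)) * (cc (int l - int k + int j) * ct_op (int j) f))"
    by (rule sum.reindex_bij_witness[of _ "\<lambda>j. int l - int k + int j" "\<lambda>n. nat (n - int l + int k)"])
      (auto simp: algebra_simps)
  finally show ?thesis .
qed

text \<open>The term \<open>m = 0\<close> of the exchange relation is the product in the opposite order. The summation
  bound may be changed from \<open>l\<close> to \<open>k\<close> because all terms beyond either bound vanish.\<close>

lemma ct_op_cc_commutator: "ct_op (int k) (cc (int l) * f) = cc (int l) * ct_op (int k) f + Ctilde k l f"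
proof -
  let ?t = "\<lambda>m. scal (exchange_coeff (int m)) * (cc (int l - int m) * ct_op (int k - int m) f)"
  have "ct_op (int k) (cc (int l) * f) = (\<Sum>m=0..l. ?t m)"
    by (rule ct_op_cc_mult)
  also have "\<dots> = (\<Sum>m=0..k + l. ?t m)"
    by (rule sum.mono_neutral_left) auto
  also have "\<dots> = (\<Sum>m=0..k. ?t m)"
    by (rule sum.mono_neutral_right) auto
  also have "\<dots> = cc (int l) * ct_op (int k) f + (\<Sum>m=1..k. ?t m)"
    by (simp add: sum.atLeast_Suc_atMost[of 0] One_nat_def)
  also have "(\<Sum>m=1..k. ?t m) = Ctilde k l f"
    unfolding Ctilde_eq
    by (rule sum.reindex_bij_witness[of _ "\<lambda>j. k - j" "\<lambda>m. k - m"]) (auto simp: of_nat_diff algebra_simps)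
  finally show ?thesis .
qed

lemma Ctilde_eq_0:
  assumes "\<And>\<beta>. \<beta> \<in> Poly_Mapping.keys f \<Longrightarrow> weight \<beta> \<le> W" "k > l + W"
  shows "Ctilde k l f = 0"
  unfolding Ctilde_eq
proof (rule sum.neutral, intro ballI)
  fix j assume "j \<in> {..<k}"
  show "scal (exchange_coeff (int k - int j)) * (cc (int l - int k + int j) * ct_op (int j) f) = 0"
  proof (cases "l + j < k")
    case False
    then have "ct_op (int j) f = 0"
      using assms by (intro ct_op_eq_0) (fastforce dest: assms(1))
    then show ?thesis by simp
  qed simp
qed

abbreviation (input) bilinear_term :: "nat \<times> nat \<Rightarrow> superpoly \<Rightarrow> superpoly" where
  "bilinear_term \<equiv> (\<lambda>(k, l) x. lift_op (Ctilde k l) (pi_op k (dpi_op l x)))"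

text \<open>Only finitely many \<open>l\<close> occur as indices in \<open>x\<close>. For each of them \<open>Ctilde k l\<close> involves derivatives
  of total weight at least \<open>k - l\<close>, which bounds \<open>k\<close>.\<close>

lemma locally_finite_bilinear_term: "locally_finite ({1..} \<times> {1..}) bilinear_term"
  unfolding locally_finite_def
proof
  fix x :: superpoly
  interpret pi: additive "pi_op k" for k by (rule pi_op_additive)
  interpret dpi: additive "dpi_op k" for k by (rule dpi_op_additive)
  interpret lift: additive "lift_op (Ctilde k l)" for k l
    by (intro lift_op_additive Ctilde_additive)
  let ?keys = "Poly_Mapping.keys x"
  have "\<forall>I. \<exists>W. \<forall>\<beta>\<in>Poly_Mapping.keys (Poly_Mapping.lookup x I). weight \<beta> \<le> W"
    using weight_bound by metis
  then obtain W where W: "\<And>I \<beta>. \<beta> \<in> Poly_Mapping.keys (Poly_Mapping.lookup x I) \<Longrightarrow> weight \<beta> \<le> W I"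
    by metis
  define W' where "W' = (\<Sum>I\<in>?keys. W I)"
  have W': "weight \<beta> \<le> W'" if "\<beta> \<in> Poly_Mapping.keys (Poly_Mapping.lookup x I)" for I \<beta>
  proof -
    have "I \<in> ?keys" using that by (auto simp: in_keys_iff)
    then have "W I \<le> W'" unfolding W'_def by (intro member_le_sum) auto
    then show ?thesis using W[OF that] by simp
  qed
  let ?L = "Suc ` (\<Union>I\<in>?keys. fset I)"
  have "{kl \<in> {1..} \<times> {1..}. bilinear_term kl x \<noteq> 0} \<subseteq> (\<Union>l\<in>?L. {..l + W'} \<times> {l})"
  proof
    fix kl assume "kl \<in> {kl \<in> {1..} \<times> {1..}. bilinear_term kl x \<noteq> 0}"
    then obtain k l where kl: "kl = (k, l)" "k \<ge> 1" "l \<ge> 1"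
      and nz: "lift_op (Ctilde k l) (pi_op k (dpi_op l x)) \<noteq> 0" by auto
    have "dpi_op l x \<noteq> 0" using nz by (auto simp: pi.zero lift.zero)
    then obtain I where "I \<in> ?keys" "l - 1 |\<in>| I"
      unfolding dpi_op_def by (elim sum.not_neutral_contains_not_neutral) (fastforce split: if_splits)
    then have l: "l \<in> ?L" using kl by (intro image_eqI[of _ _ "l - 1"]) auto
    have "k \<le> l + W'"
    proof (rule ccontr)
      assume "\<not> k \<le> l + W'"
      then have "lift_op (Ctilde k l) x = 0"
        by (intro poly_mapping_eqI)
          (simp add: lookup_lift_op additive.zero[OF Ctilde_additive] Ctilde_eq_0[of _ W'] W')
      then show False using nz
        by (simp add: lift_op_pi_op lift_op_dpi_op Ctilde_additive dpi.zero pi.zero)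
    qed
    then show "kl \<in> (\<Union>l\<in>?L. {..l + W'} \<times> {l})" using kl l by blast
  qed
  then show "finite {kl \<in> {1..} \<times> {1..}. bilinear_term kl x \<noteq> 0}"
    by (rule finite_subset) auto
qed

lemma dpi_pi_op:
  assumes "k \<ge> 1" "l \<ge> 1"
  shows "dpi_op k (pi_op l x) = (if k = l then x else 0) - pi_op l (dpi_op k x)"
  using anticommutator_dpi_pi[OF assms, of x] by (simp add: anticommutator_def eq_diff_eq)

lemma anticommutator_modes:
  assumes k: "k \<ge> 1" and l: "l \<ge> 1"
  shows "anticommutator (\<lambda>x. lift_op (\<lambda>f. cc (int k) * f) (dpi_op k x))
      (\<lambda>x. pi_op l (lift_op (ct_op (int l)) x)) x =
    (if k = l then lift_op (\<lambda>f. cc (int k) * ct_op (int k) f) x else 0) + bilinear_term (l, k) x"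
proof -
  let ?c = "\<lambda>f. cc (int k) * f" and ?t = "ct_op (int l)"
  interpret lift: additive "lift_op ?c" by (intro lift_op_additive cc_mult_additive)
  have zero: "?t 0 = 0" "Ctilde l k 0 = 0" by (simp_all add: additive.zero[OF Ctilde_additive])
  have "lift_op ?c (dpi_op k (pi_op l (lift_op ?t x))) =
      (if k = l then lift_op (\<lambda>f. cc (int k) * ct_op (int k) f) x else 0) -
      lift_op (\<lambda>f. ?c (?t f)) (pi_op l (dpi_op k x))"
    unfolding dpi_pi_op[OF k l]
    by (simp add: lift.diff lift.zero lift_op_pi_op[OF ct_op_additive, symmetric]
       lift_op_dpi_op[OF ct_op_additive, symmetric] lift_op_lift_op)
  moreover have "pi_op l (lift_op ?t (lift_op ?c (dpi_op k x))) =
      lift_op (\<lambda>f. ?t (?c f)) (pi_op l (dpi_op k x))"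
    by (simp only: lift_op_pi_op[OF ct_op_additive, symmetric]
       lift_op_pi_op[OF cc_mult_additive, symmetric]) (simp add: lift_op_lift_op)
  moreover have "lift_op (\<lambda>f. ?t (?c f)) y = lift_op (\<lambda>f. ?c (?t f)) y + lift_op (Ctilde l k) y" for y
    unfolding ct_op_cc_commutator by (rule lift_op_add_op) (simp_all add: zero)
  ultimately show ?thesis by (simp add: anticommutator_def)
qed

text \<open>The partial sums have to be long enough for \<open>E\<close> and \<open>F\<close> on \<open>x\<close>, for \<open>E\<close> on \<open>F x\<close> and for \<open>F\<close> on
  \<open>E x\<close>; then everything reduces to the anticommutators of single modes.\<close>

lemma eventually_anticommutator_E20_F2m1:
  "\<forall>\<^sub>F M in sequentially. anticommutator E20 F2m1 x =
    - ((\<Sum>k=1..M. lift_op (\<lambda>f. cc (int k) * ct_op (int k) f) x) +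
       (\<Sum>k=1..M. \<Sum>l=1..M. bilinear_term (k, l) x))"
proof -
  let ?E = "\<lambda>k x. lift_op (\<lambda>f. cc (int k) * f) (dpi_op k x)"
  let ?F = "\<lambda>k x. pi_op k (lift_op (ct_op (int k)) x)"
  have E: "\<forall>\<^sub>F M in sequentially. E20 y = (\<Sum>k=1..M. ?E k y)" for y
    unfolding E20_def by (rule eventually_op_sum_from_1[OF locally_finite_E20])
  have F: "\<forall>\<^sub>F M in sequentially. F2m1 y = - (\<Sum>k=1..M. ?F k y)" for y
    using eventually_op_sum_from_1[OF locally_finite_F2m1] unfolding F2m1_def
    by eventually_elim simp
  interpret E: additive "?E k" for k
    unfolding additive_def
    by (simp add: additive.add[OF dpi_op_additive] additive.add[OF lift_op_additive[OF cc_mult_additive]])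
  interpret F: additive "?F k" for k
    unfolding additive_def
    by (simp add: additive.add[OF pi_op_additive] additive.add[OF lift_op_additive[OF ct_op_additive]])
  show ?thesis
    using E[of x] F[of x] E[of "F2m1 x"] F[of "E20 x"]
  proof eventually_elim
    case (elim M)
    have "E20 (F2m1 x) = (\<Sum>k=1..M. ?E k (F2m1 x))" by (rule elim(3))
    also have "\<dots> = - (\<Sum>k=1..M. \<Sum>l=1..M. ?E k (?F l x))"
      by (simp only: elim(2) E.minus E.sum sum_negf)
    finally have EF: "E20 (F2m1 x) = - (\<Sum>k=1..M. \<Sum>l=1..M. ?E k (?F l x))" .
    have "F2m1 (E20 x) = - (\<Sum>l=1..M. ?F l (E20 x))" by (rule elim(4))
    also have "\<dots> = - (\<Sum>l=1..M. \<Sum>k=1..M. ?F l (?E k x))"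
      by (simp only: elim(1) F.sum)
    also have "\<dots> = - (\<Sum>k=1..M. \<Sum>l=1..M. ?F l (?E k x))"
      by (subst sum.swap) (rule refl)
    finally have FE: "F2m1 (E20 x) = - (\<Sum>k=1..M. \<Sum>l=1..M. ?F l (?E k x))" .
    from EF FE have "anticommutator E20 F2m1 x =
        - (\<Sum>k=1..M. \<Sum>l=1..M. anticommutator (?E k) (?F l) x)"
      by (simp only: anticommutator_def sum.distrib minus_add_distrib)
    also have "(\<Sum>k=1..M. \<Sum>l=1..M. anticommutator (?E k) (?F l) x) =
      (\<Sum>k=1..M. \<Sum>l=1..M. (if k = l then lift_op (\<lambda>f. cc (int k) * ct_op (int k) f) x else 0)
         + bilinear_term (l, k) x)"
      by (intro sum.cong refl anticommutator_modes) auto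
    also have "\<dots> = (\<Sum>k=1..M. lift_op (\<lambda>f. cc (int k) * ct_op (int k) f) x) +
       (\<Sum>k=1..M. \<Sum>l=1..M. bilinear_term (l, k) x)"
      by (simp add: sum.distrib)
    also have "(\<Sum>k=1..M. \<Sum>l=1..M. bilinear_term (l, k) x) =
       (\<Sum>k=1..M. \<Sum>l=1..M. bilinear_term (k, l) x)"
      by (rule sum.swap)
    finally show ?case .
  qed
qed

section \<open>Bosonic and fermionic parts\<close>

lemma at_dp_eq_sum_superset:
  "at_dp P f = (\<Sum>\<alpha>\<in>S. scal (Poly_Mapping.lookup P \<alpha>) * dp_monom \<alpha> f)"
  if "finite S" "Poly_Mapping.keys P \<subseteq> S"
  unfolding at_dp_def using that by (intro sum.mono_neutral_left) (auto simp: in_keys_iff)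

text \<open>The coefficient of \<open>z^{-j}\<close> in \<open>c~\<close> is homogeneous of weight \<open>j\<close>, so the monomial \<open>\<alpha>\<close> in the
  derivatives occurs in the sum over all \<open>j\<close> only once, for \<open>j = weight \<alpha>\<close>.\<close>

lemma boson_op_of_ct_series:
  assumes L: "\<And>f. \<forall>\<^sub>F M in sequentially. L f = (\<Sum>j=0..M. g j * ct_op (int j) f)"
  shows "boson_op L"
proof -
  define a where "a \<alpha> = g (weight \<alpha>) * scal (Poly_Mapping.lookup (fps_nth ct_series (weight \<alpha>)) \<alpha>)"
    for \<alpha>
  have "L f = op_sum UNIV (\<lambda>\<alpha> f. a \<alpha> * dp_monom \<alpha> f) f" for f
  proof -
    obtain W where W: "\<And>\<beta>. \<beta> \<in> Poly_Mapping.keys f \<Longrightarrow> weight \<beta> \<le> W" using weight_bound by blast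
    obtain M where M: "L f = (\<Sum>j=0..M. g j * ct_op (int j) f)" "M \<ge> W"
      using eventually_happens'[OF sequentially_bot
          eventually_conj[OF L[of f] eventually_ge_at_top[of W]]] by blast
    have "op_sum UNIV (\<lambda>\<alpha> f. a \<alpha> * dp_monom \<alpha> f) f = (\<Sum>\<alpha> | weight \<alpha> \<le> M. a \<alpha> * dp_monom \<alpha> f)"
    proof (rule op_sum_eq_sum)
      show "{\<alpha> \<in> UNIV. a \<alpha> * dp_monom \<alpha> f \<noteq> 0} \<subseteq> {\<alpha>. weight \<alpha> \<le> M}"
      proof (rule subsetI, rule ccontr)
        fix \<alpha> assume \<alpha>: "\<alpha> \<in> {\<alpha> \<in> UNIV. a \<alpha> * dp_monom \<alpha> f \<noteq> 0}" "\<alpha> \<notin> {\<alpha>. weight \<alpha> \<le> M}"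
        then have "dp_monom \<alpha> f = 0"
          using W M(2) by (intro dp_monom_eq_0) fastforce
        then show False using \<alpha>(1) by simp
      qed
    qed (simp_all add: finite_weight_le)
    also have "\<dots> = (\<Sum>j=0..M. \<Sum>\<alpha> | \<alpha> \<in> {\<alpha>. weight \<alpha> \<le> M} \<and> weight \<alpha> = j. a \<alpha> * dp_monom \<alpha> f)"
      by (rule sum.group[symmetric]) (auto simp: finite_weight_le)
    also have "\<dots> = (\<Sum>j=0..M. g j * ct_op (int j) f)"
    proof (rule sum.cong[OF refl])
      fix j assume j: "j \<in> {0..M}"
      let ?S = "{\<alpha>. \<alpha> \<in> {\<alpha>. weight \<alpha> \<le> M} \<and> weight \<alpha> = j}"
      have fin: "finite ?S" using finite_weight_le[of M] by (rule rev_finite_subset) auto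
      have keys: "Poly_Mapping.keys (fps_nth ct_series j) \<subseteq> ?S"
        using graded_ct_series j by (auto simp: graded_def)
      have "ct_op (int j) f = (\<Sum>\<alpha>\<in>?S. scal (Poly_Mapping.lookup (fps_nth ct_series j) \<alpha>) * dp_monom \<alpha> f)"
        unfolding at_dp_eq_sum_superset[OF fin keys, symmetric] by (simp add: ct_op_def)
      then show "(\<Sum>\<alpha>\<in>?S. a \<alpha> * dp_monom \<alpha> f) = g j * ct_op (int j) f"
        by (auto simp: a_def sum_distrib_left mult.assoc intro!: sum.cong)
    qed
    finally show ?thesis using M(1) by simp
  qed
  then have "L = op_sum UNIV (\<lambda>\<alpha> f. a \<alpha> * dp_monom \<alpha> f)" by (rule ext)
  then show ?thesis unfolding boson_op_def by blast
qed

lemma boson_op_zero_arg: "boson_op L \<Longrightarrow> L 0 = 0"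
  by (auto simp: boson_op_def op_sum_def)

lemma boson_op_zero: "boson_op (\<lambda>f. 0)"
  unfolding boson_op_def by (rule exI[of _ "\<lambda>\<alpha>. 0"]) (simp add: op_sum_def fun_eq_iff)

lemma boson_op_Ctilde: "boson_op (\<lambda>f. scal a * Ctilde k l f)"
proof (rule boson_op_of_ct_series)
  fix f
  let ?g = "\<lambda>j. if j < k then scal (a * exchange_coeff (int k - int j)) * cc (int l - int k + int j) else 0"
  have "scal a * Ctilde k l f = (\<Sum>j=0..M. ?g j * ct_op (int j) f)" if "M \<ge> k" for M
  proof -
    have "scal a * Ctilde k l f = (\<Sum>j<k. ?g j * ct_op (int j) f)"
      unfolding Ctilde_eq sum_distrib_left by (rule sum.cong) (auto simp: scal_mult mult.assoc)
    also have "\<dots> = (\<Sum>j=0..M. ?g j * ct_op (int j) f)"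
      using that by (intro sum.mono_neutral_left) auto
    finally show ?thesis .
  qed
  then show "\<forall>\<^sub>F M in sequentially. scal a * Ctilde k l f = (\<Sum>j=0..M. ?g j * ct_op (int j) f)"
    unfolding eventually_sequentially by blast
qed

definition bosonic_part :: "kpoly \<Rightarrow> kpoly" where
  "bosonic_part f = scal (1 / (1 - tt)) * op_sum {1..} (\<lambda>k f. cc (int k) * ct_op (int k) f) f"

definition fermionic_part :: "superpoly \<Rightarrow> superpoly" where
  "fermionic_part x = smult_R (1 / (1 - tt)) (op_sum ({1..} \<times> {1..}) bilinear_term x)"

lemma locally_finite_cc_ct_op: "locally_finite {1..} (\<lambda>k f. cc (int k) * ct_op (int k) f)"
  unfolding locally_finite_def
proof
  fix f :: kpoly
  obtain W where W: "\<And>\<beta>. \<beta> \<in> Poly_Mapping.keys f \<Longrightarrow> weight \<beta> \<le> W" using weight_bound by blast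
  have "ct_op (int k) f = 0" if "k > W" for k
    using W that by (intro ct_op_eq_0) fastforce
  then have "{k \<in> {1..}. cc (int k) * ct_op (int k) f \<noteq> 0} \<subseteq> {..W}"
    by (auto simp: not_le[symmetric])
  then show "finite {k \<in> {1..}. cc (int k) * ct_op (int k) f \<noteq> 0}"
    by (rule finite_subset) simp
qed

lemma eventually_bosonic_part:
  "\<forall>\<^sub>F M in sequentially. bosonic_part f =
     scal (1 / (1 - tt)) * (\<Sum>k=1..M. cc (int k) * ct_op (int k) f)"
  using eventually_op_sum_from_1[OF locally_finite_cc_ct_op, of f]
  unfolding bosonic_part_def by eventually_elim simp

lemma boson_op_bosonic_part: "boson_op bosonic_part"
proof (rule boson_op_of_ct_series)
  fix f
  let ?g = "\<lambda>j. if j = 0 then 0 else scal (1 / (1 - tt)) * cc (int j)"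
  show "\<forall>\<^sub>F M in sequentially. bosonic_part f = (\<Sum>j=0..M. ?g j * ct_op (int j) f)"
    using eventually_bosonic_part[of f]
  proof eventually_elim
    case (elim M)
    have "bosonic_part f = (\<Sum>j=1..M. ?g j * ct_op (int j) f)"
      unfolding elim sum_distrib_left by (rule sum.cong) (auto simp: mult.assoc)
    also have "\<dots> = (\<Sum>j=0..M. ?g j * ct_op (int j) f)"
      by (rule sum.mono_neutral_left) (auto simp: Suc_le_eq One_nat_def)
    finally show ?case .
  qed
qed

lemma power_sum_subst_bosonic_part:
  assumes "N \<ge> 1"
  shows "to_frac (power_sum_subst N (bosonic_part f)) = RM_inverted N (power_sum_subst N f)"
proof -
  have "\<forall>\<^sub>F M::nat in sequentially. to_frac (power_sum_subst N (bosonic_part f)) =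
      RM_inverted N (power_sum_subst N f)"
    using power_sum_subst_eq_RM_inverted[OF assms, of f] eventually_bosonic_part[of f]
    by eventually_elim simp
  then show ?thesis by simp
qed

lemma eventually_lift_op_bosonic_part:
  "\<forall>\<^sub>F M in sequentially. lift_op bosonic_part x =
     smult_R (1 / (1 - tt)) (\<Sum>k=1..M. lift_op (\<lambda>f. cc (int k) * ct_op (int k) f) x)"
proof -
  have "\<forall>\<^sub>F M in sequentially. \<forall>I\<in>Poly_Mapping.keys x. bosonic_part (Poly_Mapping.lookup x I) =
     scal (1 / (1 - tt)) * (\<Sum>k=1..M. cc (int k) * ct_op (int k) (Poly_Mapping.lookup x I))"
    by (intro eventually_ball_finite) (auto intro: eventually_bosonic_part)
  then show ?thesis
  proof eventually_elim
    case (elim M)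
    have B0: "bosonic_part 0 = 0" by (rule boson_op_zero_arg[OF boson_op_bosonic_part])
    show ?case
    proof (rule poly_mapping_eqI)
      fix I
      have "bosonic_part (Poly_Mapping.lookup x I) =
         scal (1 / (1 - tt)) * (\<Sum>k=1..M. cc (int k) * ct_op (int k) (Poly_Mapping.lookup x I))"
        using elim by (cases "I \<in> Poly_Mapping.keys x") (auto simp: B0 in_keys_iff)
      then show "Poly_Mapping.lookup (lift_op bosonic_part x) I = Poly_Mapping.lookup
          (smult_R (1 / (1 - tt)) (\<Sum>k=1..M. lift_op (\<lambda>f. cc (int k) * ct_op (int k) f) x)) I"
        by (simp add: lookup_smult_R lookup_sum lookup_lift_op[of bosonic_part, OF B0]
          lookup_lift_op[of "\<lambda>f. cc (int _) * ct_op (int _) f"])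
    qed
  qed
qed

lemma D2_eq:
  assumes "anticommutator E20 F2m1 = (\<lambda>x. x - smult_R (th / qh * uu) (H x))"
  shows "D2 H x = lift_op bosonic_part x + fermionic_part x"
proof -
  interpret additive "smult_R a" for a by (rule smult_R_additive)
  have H: "smult_R (th / qh * uu) (H x) - x = - anticommutator E20 F2m1 x"
    unfolding assms by simp
  have "\<forall>\<^sub>F M::nat in sequentially. D2 H x = lift_op bosonic_part x + fermionic_part x"
    using eventually_anticommutator_E20_F2m1[of x] eventually_lift_op_bosonic_part[of x]
      eventually_op_sum_pairs_from_1[OF locally_finite_bilinear_term, of x]
  proof eventually_elim
    case (elim M)
    show ?case
      unfolding D2_def H elim(1) elim(2) fermionic_part_def elim(3) minus_minus add ..
  qed
  then show ?thesis by simp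
qed

lemma singleton_monom_ops [simp]: "pi_monom {|i|} = pi_op (Suc i)" "dpi_monom {|i|} = dpi_op (Suc i)"
  by (simp_all add: pi_monom_def dpi_monom_def sorted_list_of_fset.rep_eq fun_eq_iff)

text \<open>The bilinear terms are the normal ordered terms in which both sets of fermions are
  singletons; all other coefficients are zero. The slots of \<open>\<pi>_k\<close> and \<open>\<partial>/\<partial>\<pi>_l\<close> are \<open>k - 1\<close> and \<open>l - 1\<close>.\<close>

lemma fermion_op_fermionic_part: "fermion_op fermionic_part"
proof -
  let ?s = "1 / (1 - tt)"
  define singletons where "singletons = range (\<lambda>(i::nat, j::nat). ({|i|}, {|j|}))"
  define B where "B = (\<lambda>(I, J). if (I, J) \<in> singletons
     then (\<lambda>f. scal ?s * Ctilde (Suc (fthe_elem I)) (Suc (fthe_elem J)) f) else (\<lambda>f. 0))"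
  define A where "A = (\<lambda>(I, J) x. lift_op (B (I, J)) (pi_monom I (dpi_monom J x)))"
  let ?S = "UNIV - {({||}, {||})} :: (nat fset \<times> nat fset) set"
  let ?T = "\<lambda>kl x. smult_R ?s (bilinear_term kl x)"
  let ?h = "\<lambda>(k::nat, l::nat). ({|k - 1|}, {|l - 1|})"
  have s: "?s \<noteq> 0" using tt_neq_1 by simp
  have inj: "inj_on ?h ({1..} \<times> {1..})" by (auto simp: inj_on_def)
  have im: "?h ` ({1..} \<times> {1..}) = singletons"
  proof
    show "singletons \<subseteq> ?h ` ({1..} \<times> {1..})"
    proof (clarsimp simp: singletons_def)
      fix i j :: nat
      show "({|i|}, {|j|}) \<in> ?h ` ({1..} \<times> {1..})"
        by (rule image_eqI[of _ _ "(Suc i, Suc j)"]) auto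
    qed
  qed (auto simp: singletons_def)
  have sub: "?h ` ({1..} \<times> {1..}) \<subseteq> ?S" by auto
  have zero: "A IJ x = 0" if "IJ \<in> ?S - ?h ` ({1..} \<times> {1..})" for IJ x
    using that unfolding im by (cases IJ) (simp add: A_def B_def lift_op_def map_eq_zero_iff)
  have eq: "A (?h kl) x = ?T kl x" if S: "kl \<in> {1..} \<times> {1..}" for kl x
  proof -
    obtain k l where kl: "kl = (k, l)" "k \<ge> 1" "l \<ge> 1" using S by auto
    have "?h kl \<in> singletons" using S im by blast
    then show ?thesis using kl
      by (simp add: A_def B_def smult_R_lift_op additive.zero[OF Ctilde_additive])
  qed
  have lf: "locally_finite ({1..} \<times> {1..}) ?T"
    using locally_finite_bilinear_term s by (simp add: locally_finite_def smult_R_eq_0_iff)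
  have "fermionic_part = op_sum ({1..} \<times> {1..}) ?T"
    by (rule ext) (simp add: fermionic_part_def op_sum_def smult_R_eq_0_iff[OF s]
      additive.sum[OF smult_R_additive])
  also have "\<dots> = op_sum ?S A"
    by (rule op_sum_reindex[where h = ?h and A = ?T and B = A, OF inj sub zero eq, symmetric])
  finally have "fermionic_part = op_sum ?S A" .
  moreover have "locally_finite ?S A"
    by (rule locally_finite_reindex[where h = ?h and A = ?T and B = A, OF inj sub zero eq lf])
  moreover have "boson_op (B IJ)" for IJ
    by (cases IJ) (simp add: B_def boson_op_Ctilde boson_op_zero)
  ultimately show ?thesis
    unfolding fermion_op_def Let_def A_def by blast
qed

lemma dpi_monom_from_poly: "J \<noteq> {||} \<Longrightarrow> dpi_monom J (from_poly f) = 0"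
proof -
  assume "J \<noteq> {||}"
  then have ne: "sorted_list_of_fset J \<noteq> []"
    by (metis sorted_list_of_fset_simps(2) fset_of_list_simps(1))
  have "foldr (\<lambda>i. dpi_op (Suc i)) is (0::superpoly) = 0" for "is"
    by (induction "is") (simp_all add: additive.zero[OF dpi_op_additive])
  moreover obtain "is" i where "sorted_list_of_fset J = is @ [i]"
    using ne by (metis rev_exhaust)
  ultimately show ?thesis by (simp add: dpi_monom_def dpi_op_from_poly)
qed

lemma pi_monom_0: "pi_monom I 0 = 0"
proof -
  have "foldr (\<lambda>i. pi_op (Suc i)) is (0::superpoly) = 0" for "is"
    by (induction "is") (simp_all add: additive.zero[OF pi_op_additive])
  then show ?thesis by (simp add: pi_monom_def)
qed

lemma lookup_pi_monom_empty: "I \<noteq> {||} \<Longrightarrow> Poly_Mapping.lookup (pi_monom I x) {||} = 0"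
proof -
  assume "I \<noteq> {||}"
  then have "sorted_list_of_fset I \<noteq> []"
    by (metis sorted_list_of_fset_simps(2) fset_of_list_simps(1))
  then obtain i "is" where "sorted_list_of_fset I = i # is" by (meson list.exhaust)
  then show ?thesis by (simp add: pi_monom_def lookup_pi_op)
qed

text \<open>A derivative \<open>\<partial>/\<partial>\<pi>\<close> kills polynomials, and a factor \<open>\<pi>\<close> on the left leaves no component of
  exterior degree zero.\<close>

lemma fermion_op_from_poly:
  assumes "fermion_op T"
  shows "Poly_Mapping.lookup (T (from_poly f)) {||} = 0"
proof -
  obtain B where B: "\<And>IJ. IJ \<in> UNIV - {({||}, {||})} \<Longrightarrow> boson_op (B IJ)"
    and T: "T = op_sum (UNIV - {({||}, {||})})
      (\<lambda>(I, J) x. lift_op (B (I, J)) (pi_monom I (dpi_monom J x)))"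
    using assms unfolding fermion_op_def Let_def by blast
  show ?thesis
    unfolding T op_sum_def lookup_sum
  proof (rule sum.neutral, intro ballI)
    let ?A = "\<lambda>(I, J) x. lift_op (B (I, J)) (pi_monom I (dpi_monom J x))"
    fix IJ assume "IJ \<in> {IJ \<in> UNIV - {({||}, {||})}. ?A IJ (from_poly f) \<noteq> 0}"
    then obtain I J where IJ: "IJ = (I, J)" "\<not> (I = {||} \<and> J = {||})" by (cases IJ) auto
    then have "B (I, J) 0 = 0" by (intro boson_op_zero_arg B) auto
    then show "Poly_Mapping.lookup (?A IJ (from_poly f)) {||} = 0"
      using IJ by (cases "J = {||}")
        (simp_all add: lookup_lift_op dpi_monom_from_poly pi_monom_0 lookup_pi_monom_empty)
  qed
qed

lemma boson_fermion_parts_unique: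
  assumes "boson_fermion_parts T L X" "boson_fermion_parts T L' X'"
  shows "L = L'" "X = X'"
proof -
  have from_poly: "Poly_Mapping.lookup (from_poly f) {||} = f" for f by (simp add: from_poly_def)
  have L: "K f = Poly_Mapping.lookup (T (from_poly f)) {||}" if "boson_fermion_parts T K Y" for K Y f
    using that unfolding boson_fermion_parts_def
    by (auto simp: lookup_add fermion_op_from_poly lookup_lift_op boson_op_zero_arg from_poly)
  show "L = L'" using L[OF assms(1)] L[OF assms(2)] by (simp add: fun_eq_iff)
  with assms have "lift_op L x + X x = lift_op L x + X' x" for x
    unfolding boson_fermion_parts_def by metis
  then show "X = X'" by (simp add: fun_eq_iff)
qed

theorem proposition4p1:
  fixes H :: "superpoly \<Rightarrow> superpoly"
  assumes "anticommutator E20 F2m1 = (\<lambda>x. x - smult_R (th / qh * uu) (H x))"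
  shows "(\<exists>DB DF. boson_fermion_parts (D2 H) DB DF) \<and>
    (\<forall>DB DF. boson_fermion_parts (D2 H) DB DF \<longrightarrow>
      (\<forall>N\<ge>1. \<forall>f :: kpoly.
         to_frac (power_sum_subst N (DB f)) = RM_inverted N (power_sum_subst N f)) \<and>
      (let A = (\<lambda>(k, l) x. lift_op (Ctilde k l) (pi_op k (dpi_op l x))) in
         locally_finite ({1..} \<times> {1..}) A \<and>
         DF = (\<lambda>x. smult_R (1 / (1 - tt)) (op_sum ({1..} \<times> {1..}) A x))))"
proof -
  have parts: "boson_fermion_parts (D2 H) bosonic_part fermionic_part"
    unfolding boson_fermion_parts_def
    using boson_op_bosonic_part fermion_op_fermionic_part D2_eq[OF assms] by blast
  show ?thesis
    unfolding Let_def
  proof (intro conjI allI impI)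
    show "\<exists>DB DF. boson_fermion_parts (D2 H) DB DF" using parts by blast
  next
    fix DB DF and N :: nat and f
    assume D: "boson_fermion_parts (D2 H) DB DF" and N: "N \<ge> 1"
    show "to_frac (power_sum_subst N (DB f)) = RM_inverted N (power_sum_subst N f)"
      unfolding boson_fermion_parts_unique(1)[OF D parts] by (rule power_sum_subst_bosonic_part[OF N])
  next
    show "locally_finite ({1..} \<times> {1..}) bilinear_term"
      by (rule locally_finite_bilinear_term)
  next
    fix DB DF
    assume D: "boson_fermion_parts (D2 H) DB DF"
    show "DF = (\<lambda>x. smult_R (1 / (1 - tt)) (op_sum ({1..} \<times> {1..}) bilinear_term x))"
      unfolding boson_fermion_parts_unique(2)[OF D parts] fermionic_part_def ..
  qed
qed

end
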